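(* Let $n\ge 3$ and let $G$ be (the skeleton graph of) any triangulation of the $n$-gon. Then the graphical zonotope $Z_G$ has face vector $f=(f_0,f_1,\dots,f_{n-1})$, where for $i=0,\dots,n-1$, $$f_{n-1-i}=\sum_{m=0}^{\min\{i,n-i\}}2^m\,3^{i-m}\binom{i-1}{m-1}\binom{n}{m+i}.$$
   Context: The $n$-gon is a $2$-dimensional convex polytope with $n$ edges. A triangulation of the $n$-gon is a subdivision of it into triangles by non-crossing diagonals, using only the $n$ vertices of the polygon; its skeleton graph is the graph on the $n$ polygon vertices (labelled $1,\dots,n$) whose edges are the sides of the polygon together with the diagonals used in the triangulation. For a simple connected graph $G$ on vertex set $\{1,\dots,n\}$ with edge set $E(G)$, the graphical zonotope is the Minkowski sum $Z_G=\sum_{ij\in E(G)}[e_i,e_j]\subset\mathbb{R}^n$, where $e_1,\dots,e_n$ are the coordinate vectors of $\mathbb{R}^n$. It is a polytope of dimension $n-1$. The number $f_j$ is the number of $j$-dimensional faces of $Z_G$, where $Z_G$ itself counts as its unique $(n-1)$-dimensional face. Convention for binomial coefficients with lower index $-1$: $\binom{-1}{-1}=1$, and $\binom{i-1}{-1}=0$ for $i\ge 1$. *)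

theory Defs
  imports "HOL-Analysis.Analysis" "HOL-Library.Set_Algebras"
begin

definition polygon :: "nat \<Rightarrow> (real^2) set \<Rightarrow> bool" where
  "polygon n P \<longleftrightarrow> polytope P \<and> aff_dim P = 2 \<and> card {e. e edge_of P} = n"

text \<open>
  A subdivision is given by its set of closed triangles; the library notion \<^const>\<open>triangulation\<close>
  makes them meet face to face.  Since all their corners are vertices of the polygon, the sides of
  these triangles are sides of the polygon or pairwise non-crossing diagonals.
\<close>

definition polygon_triangulation :: "(real^2) set \<Rightarrow> (real^2) set set \<Rightarrow> bool" where
  "polygon_triangulation P \<T> \<longleftrightarrow>
     triangulation \<T> \<and> \<Union>\<T> = P \<and>
     (\<forall>T\<in>\<T>. 2 simplex T \<and> {x. x extreme_point_of T} \<subseteq> {x. x extreme_point_of P})"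

text \<open>
  Graphs are given by their edge sets, edges being two-element sets of labels.  The map \<open>v\<close> sends
  a label to the polygon vertex carrying it.  The relation \<^const>\<open>edge_of\<close> requires affine
  dimension one, so there are no loops.
\<close>

definition skeleton_edges ::
    "('n \<Rightarrow> real^2) \<Rightarrow> (real^2) set \<Rightarrow> (real^2) set set \<Rightarrow> 'n set set" where
  "skeleton_edges v P \<T> =
     {{i, j} | i j. closed_segment (v i) (v j) edge_of P \<or>
                    (\<exists>T\<in>\<T>. closed_segment (v i) (v j) edge_of T)}"

text \<open>
  The sum is the Minkowski sum of sets.  For an edge \<open>{i, j}\<close> the summand is the segment
  joining the coordinate vectors \<open>axis i 1\<close> and \<open>axis j 1\<close>.
\<close>

definition graphical_zonotope :: "'n::finite set set \<Rightarrow> (real^'n) set" where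
  "graphical_zonotope E = (\<Sum>e\<in>E. convex hull ((\<lambda>i. axis i 1) ` e))"

definition face_number :: "'a::euclidean_space set \<Rightarrow> nat \<Rightarrow> nat" where
  "face_number Z j = card {F. F face_of Z \<and> aff_dim F = int j}"

text \<open>
  The value at \<open>(-1, -1)\<close> is \<open>1\<close>, and that at \<open>(a, -1)\<close> is \<open>0\<close> for natural \<open>a\<close>.
  Other negative arguments play no role.
\<close>

definition binom :: "int \<Rightarrow> int \<Rightarrow> nat" where
  "binom a b = (if b = -1 then (if a = -1 then 1 else 0) else nat a choose nat b)"

end

theory Submission
  imports Defs "HOL-Computational_Algebra.Polynomial"
begin

text \<open>
  A nonempty face of the zonotope of a graph is the set of maximisers of a linear functional \<open>y\<close>. It
  is determined by the signs of \<open>y\<^sub>j - y\<^sub>i\<close> on the edges \<open>{i, j}\<close> (a covector), and its dimension is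
  the rank of the edges with sign zero.

  A triangulated polygon arises from one triangle by gluing triangles \<open>{a, b, v}\<close> with a new vertex
  \<open>v\<close> along boundary edges \<open>{a, b}\<close>. Indeed, triangles not yet used meet the glued part in an edge,
  by convexity, and the line through this edge separates the new vertex from the glued part. Let the
  covectors be weighted by \<open>t\<close> to the corank of their zero edges. A covector vanishing on \<open>{a, b}\<close>
  has three extensions to \<open>v\<close>, of total weight \<open>1 + 2 t\<close>; any other covector has five, of total
  weight \<open>2 + 3 t\<close>. Covectors vanishing on \<open>k\<close> boundary edges of an \<open>n\<close>-gon are counted by the same
  polynomial as all covectors of an \<open>(n - k)\<close>-gon, whence
  \<open>F\<^sub>n = (2 + 3 t) F\<^sub>n\<^sub>-\<^sub>1 - (1 + t) F\<^sub>n\<^sub>-\<^sub>2\<close>.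
\<close>

section \<open>The recursion and its closed form\<close>

text \<open>The polynomial variable is the \<open>t\<close> of the weights. The value at
  \<open>1\<close> is that of a single vertex, with one covector of corank one. The value at
  \<open>0\<close> arises when the whole boundary is required to vanish, which again leaves one
  vertex.\<close>

fun stack_poly :: "nat \<Rightarrow> int poly" where
  "stack_poly 0 = [:0, 1:]"
| "stack_poly (Suc 0) = [:0, 1:]"
| "stack_poly (Suc (Suc n)) = [:2, 3:] * stack_poly (Suc n) - [:1, 1:] * stack_poly n"

text \<open>
  The characteristic equation of \<open>stack_poly\<close> becomes \<open>\<mu>\<^sup>2 = 3 t \<mu> + 2 t\<close> under the
  substitution \<open>\<lambda> = 1 + \<mu>\<close>, so the iterated differences at \<open>0\<close> satisfy the following recursion.
\<close>

fun stack_diff :: "nat \<Rightarrow> int poly" where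
  "stack_diff 0 = 1"
| "stack_diff (Suc 0) = 0"
| "stack_diff (Suc (Suc k)) = [:0, 3:] * stack_diff (Suc k) + [:0, 2:] * stack_diff k"

text \<open>Pascal's rule: taking differences of the binomial transform amounts to shifting
  \<open>h\<close>.\<close>

lemma binomial_transform_Suc:
  fixes h :: "nat \<Rightarrow> 'a::comm_semiring_1"
  shows "(\<Sum>k\<le>Suc n. of_nat (Suc n choose k) * h k) =
    (\<Sum>k\<le>n. of_nat (n choose k) * h k) + (\<Sum>k\<le>n. of_nat (n choose k) * h (Suc k))"
proof -
  have "(\<Sum>k\<le>Suc n. of_nat (Suc n choose k) * h k) =
      h 0 + (\<Sum>k\<le>n. of_nat (n choose Suc k) * h (Suc k)) + (\<Sum>k\<le>n. of_nat (n choose k) * h (Suc k))"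
    unfolding sum.atMost_Suc_shift
    by (simp add: algebra_simps sum.distrib)
  also have "h 0 + (\<Sum>k\<le>n. of_nat (n choose Suc k) * h (Suc k)) =
      (\<Sum>k\<le>Suc n. of_nat (n choose k) * h k)"
    unfolding sum.atMost_Suc_shift by simp
  also have "\<dots> = (\<Sum>k\<le>n. of_nat (n choose k) * h k)"
    by (simp add: binomial_eq_0)
  finally show ?thesis .
qed

text \<open>Newton's forward difference formula for \<open>stack_poly n\<close> divided by
  \<open>t\<close>, whose iterated differences at \<open>0\<close> are
  \<open>stack_diff\<close>.\<close>

lemma stack_poly_eq:
  "stack_poly n = [:0, 1:] * (\<Sum>k\<le>n. of_nat (n choose k) * stack_diff k)"
proof -
  \<comment> \<open>\<open>H s\<close> is the \<open>s\<close>-th iterated difference of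
    \<open>H 0\<close> in \<open>n\<close>; by linearity it inherits the recursion of
    \<open>stack_diff\<close>.\<close>
  define H where "H s n = (\<Sum>k\<le>n. of_nat (n choose k) * stack_diff (k + s))" for s n
  have step: "H s (Suc n) = H s n + H (Suc s) n" for s n
    using binomial_transform_Suc[of n "\<lambda>k. stack_diff (k + s)"] by (simp add: H_def)
  have rec: "H (Suc (Suc 0)) n = [:0, 3:] * H (Suc 0) n + [:0, 2:] * H 0 n" for n
    unfolding H_def
    by (simp add: sum_distrib_left sum.distrib [symmetric] algebra_simps del: mult_pCons_left mult_pCons_right)
  have "stack_poly n = [:0, 1:] * H 0 n"
  proof (induction n rule: stack_poly.induct)
    case (3 n)
    have 1: "[:2, 3:] = 2 + 3 * [:0, 1 :: int:]" "[:1, 1:] = 1 + [:0, 1 :: int:]"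
      "[:0, 3:] = 3 * [:0, 1 :: int:]" "[:0, 2:] = 2 * [:0, 1 :: int:]"
      by (simp_all add: numeral_poly one_pCons)
    have "(2 + 3 * t) * (t * (a + b)) - (1 + t) * (t * a) = t * (a + b + (b + (3 * t * b + 2 * t * a)))"
      for t a b :: "int poly"
      by (simp add: algebra_simps)
    then show ?case
      unfolding stack_poly.simps 3 step rec 1 .
  qed (simp_all add: H_def)
  then show ?thesis by (simp add: H_def)
qed

text \<open>
  The bound \<open>k \<le> 2 * i\<close> is needed only for \<open>i = 0\<close>, \<open>k = 1\<close>, where \<^const>\<open>binom\<close> takes the
  junk value \<open>binom (-1) 0 = 1\<close>.
\<close>

lemma coeff_stack_diff:
  "coeff (stack_diff k) i =
    (if i \<le> k \<and> k \<le> 2 * i then 2 ^ (k - i) * 3 ^ (2 * i - k) * int (binom (int i - 1) (int (k - i) - 1)) else 0)"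
proof (induction k arbitrary: i rule: stack_diff.induct)
  case 1
  then show ?case by (auto simp: binom_def coeff_1)
next
  case 2
  then show ?case by (auto simp: binom_def)
next
  case (3 k)
  show ?case
  proof (cases i)
    case (Suc j)
    have c: "coeff (stack_diff (Suc (Suc k))) i = 3 * coeff (stack_diff (Suc k)) j + 2 * coeff (stack_diff k) j"
      by (simp add: Suc)
    \<comment> \<open>In the last range the claim is Pascal's rule. The others are boundary cases,
      in which a coefficient is zero or \<open>binom\<close> is taken at lower index -1.\<close>
    consider "k < j" | "k > 2 * j" | "k = j" | m where "k = j + Suc m" "m < j" by atomize_elim presburger
    then show ?thesis
    proof cases
      case 1
      have "coeff (stack_diff (Suc (Suc k))) i = 3 * coeff (stack_diff (Suc k)) j"
        using 1 by (subst c) (simp add: "3.IH")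
      then show ?thesis using 1 Suc
        by (auto simp: "3.IH" binom_def)
    next
      case 2
      then show ?thesis by (subst c) (auto simp: "3.IH" Suc)
    next
      case 3
      then show ?thesis unfolding c "3.IH" using Suc
        by (cases j) (auto simp: binom_def)
    next
      case (4 m)
      then obtain l where l: "j = Suc (m + l)" using less_iff_Suc_add by auto
      show ?thesis unfolding c "3.IH" using 4 Suc
        by (cases l) (auto simp: l binom_def nat_add_distrib algebra_simps Suc_diff_le nat_diff_distrib)
    qed
  qed auto
qed

text \<open>The factor \<open>t\<close> in \<open>stack_poly_eq\<close> accounts for
  \<open>Suc i\<close>. Only \<open>k\<close> from \<open>i\<close> to \<open>min (2 * i) n\<close>
  contribute, and \<open>k = m + i\<close> turns the sum into that of the theorem.\<close>

lemma coeff_stack_poly: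
  assumes "i \<le> n"
  shows "coeff (stack_poly n) (Suc i) =
    int (\<Sum>m = 0..min i (n - i). 2 ^ m * 3 ^ (i - m) * binom (int i - 1) (int m - 1) * (n choose (m + i)))"
proof -
  have cm: "coeff (of_nat c * p) j = int c * coeff p j" for c p j
    by (simp add: of_nat_poly)
  have "coeff (stack_poly n) (Suc i) = (\<Sum>k\<le>n. int (n choose k) * coeff (stack_diff k) i)"
    by (simp add: stack_poly_eq coeff_sum cm)
  also have "\<dots> = (\<Sum>k\<in>{i..min (2 * i) n}. int (n choose k) * coeff (stack_diff k) i)"
    by (rule sum.mono_neutral_right) (auto simp: coeff_stack_diff)
  also have "\<dots> = (\<Sum>m = 0..min i (n - i). int (n choose (m + i)) * coeff (stack_diff (m + i)) i)"
    by (rule sum.reindex_bij_witness[where i = "\<lambda>m. m + i" and j = "\<lambda>k. k - i"]) (use assms in auto)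
  also have "\<dots> = int (\<Sum>m = 0..min i (n - i). 2 ^ m * 3 ^ (i - m) * binom (int i - 1) (int m - 1) * (n choose (m + i)))"
    unfolding of_nat_sum by (rule sum.cong) (auto simp: coeff_stack_diff)
  finally show ?thesis .
qed

section \<open>Covectors of a graph with an ear\<close>

text \<open>Signs are encoded as a partial orientation of the graph; sign zero means that the edge
  occurs in neither direction.\<close>

definition covector :: "'n set set \<Rightarrow> real^'n \<Rightarrow> ('n::finite \<times> 'n) set" where
  "covector E y = {(i, j). {i, j} \<in> E \<and> y $ i < y $ j}"

definition zero_vectors :: "'n set set \<Rightarrow> ('n \<times> 'n) set \<Rightarrow> (real^'n::finite) set" where
  "zero_vectors E \<sigma> =
     {axis i 1 - axis j 1 | i j. {i, j} \<in> E \<and> (i, j) \<notin> \<sigma> \<and> (j, i) \<notin> \<sigma>}"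

text \<open>For a set \<open>S\<close> of edges these correspond to the covectors of the graph with
  \<open>S\<close> contracted.\<close>

definition vanishing :: "'n set set \<Rightarrow> 'n set set \<Rightarrow> ('n::finite \<times> 'n) set set" where
  "vanishing E S = {\<sigma> \<in> range (covector E). \<forall>(i, j)\<in>\<sigma>. {i, j} \<notin> S}"

text \<open>If all edges lie in \<open>V\<close>, the exponent is the number of connected components
  of the graph on \<open>V\<close> formed by the edges of sign zero.\<close>

definition covector_poly :: "'n set \<Rightarrow> 'n set set \<Rightarrow> 'n::finite set set \<Rightarrow> int poly" where
  "covector_poly V E S = (\<Sum>\<sigma>\<in>vanishing E S. monom 1 (card V - dim (zero_vectors E \<sigma>)))"

text \<open>
  The signs on \<open>{a, v}\<close> and \<open>{b, v}\<close> for the five positions of the value at \<open>v\<close> relative to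
  values at \<open>a\<close> and \<open>b\<close> with that at \<open>a\<close> smaller.
\<close>

definition cross :: "'n \<Rightarrow> 'n \<Rightarrow> 'n \<Rightarrow> ('n \<times> 'n) set set" where
  "cross a b v = {{(v, a), (v, b)}, {(v, b)}, {(a, v), (v, b)}, {(a, v)}, {(a, v), (b, v)}}"

definition extensions :: "('n \<times> 'n) set \<Rightarrow> 'n \<Rightarrow> 'n \<Rightarrow> 'n \<Rightarrow> ('n \<times> 'n) set set" where
  "extensions \<sigma> a b v =
     (if (a, b) \<in> \<sigma> then cross a b v else if (b, a) \<in> \<sigma> then cross b a v
      else {{}, {(v, a), (v, b)}, {(a, v), (b, v)}})"

lemma covector_star:
  assumes "a \<noteq> v" "b \<noteq> v"
  shows "covector {{a, v}, {b, v}} y =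
     (if y $ v < y $ a then {(v, a)} else if y $ a < y $ v then {(a, v)} else {}) \<union>
     (if y $ v < y $ b then {(v, b)} else if y $ b < y $ v then {(b, v)} else {})"
  using assms unfolding covector_def by (auto simp: doubleton_eq_iff)

lemma covector_cong:
  assumes "\<And>i. i \<in> \<Union>E \<Longrightarrow> y $ i = z $ i"
  shows "covector E y = covector E z"
proof -
  have "y $ i = z $ i \<and> y $ j = z $ j" if "{i, j} \<in> E" for i j
    using assms that by blast
  then show ?thesis unfolding covector_def by auto
qed

text \<open>The case \<open>a = b\<close> attaches \<open>v\<close> by a single edge, which lets a
  two-gon grow out of a vertex. Otherwise \<open>{a, b}\<close> is an edge, so that a covector of
  \<open>E\<close> already decides the order of the values at \<open>a\<close> and
  \<open>b\<close>.\<close>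

locale ear =
  fixes V :: "'n::finite set" and E :: "'n set set" and a b v :: 'n
  assumes E_sub: "\<Union>E \<subseteq> V" and ab: "a \<in> V" "b \<in> V" and v: "v \<notin> V"
    and ab_edge: "a = b \<or> {a, b} \<in> E"
begin

definition E' where "E' = insert {a, v} (insert {b, v} E)"

lemma covector_E': "covector E' y = covector E y \<union> covector {{a, v}, {b, v}} y"
  by (auto simp: E'_def covector_def)

lemma neq: "a \<noteq> v" "b \<noteq> v" using ab v by auto

lemma edge_iff: "(a, b) \<in> covector E y \<longleftrightarrow> y $ a < y $ b" "(b, a) \<in> covector E y \<longleftrightarrow> y $ b < y $ a"
  using ab_edge by (auto simp: covector_def insert_commute)

lemma covector_star_in: "covector {{a, v}, {b, v}} y \<in> extensions (covector E y) a b v"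
  unfolding extensions_def cross_def edge_iff covector_star[OF neq] by auto

text \<open>As \<open>v\<close> lies outside \<open>V\<close>, the value at \<open>v\<close> can be
  changed to any \<open>x\<close> without affecting the signs on \<open>E\<close>.\<close>

lemma extension_realised:
  assumes "\<tau> \<in> extensions (covector E y) a b v"
  obtains z where "covector E z = covector E y" "covector {{a, v}, {b, v}} z = \<tau>"
proof -
  have *: "\<exists>z. covector E z = covector E y \<and> covector {{a, v}, {b, v}} z = \<tau>"
    if "(if x < y $ a then {(v, a)} else if y $ a < x then {(a, v)} else {}) \<union>
     (if x < y $ b then {(v, b)} else if y $ b < x then {(b, v)} else {}) = \<tau>" for x
  proof (intro exI conjI)
    let ?z = "\<chi> i. if i = v then x else y $ i"
    show "covector E ?z = covector E y"
      by (rule covector_cong) (use v E_sub in auto)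
    show "covector {{a, v}, {b, v}} ?z = \<tau>"
      unfolding covector_star[OF neq] that [symmetric] using neq by simp
  qed
  have "\<exists>x. (if x < y $ a then {(v, a)} else if y $ a < x then {(a, v)} else {}) \<union>
     (if x < y $ b then {(v, b)} else if y $ b < x then {(b, v)} else {}) = \<tau>"
  proof -
    consider "y $ a < y $ b" | "y $ b < y $ a" | "y $ a = y $ b" by linarith
    then show ?thesis
    proof cases
      case 1
      then consider "\<tau> = {(v, a), (v, b)}" | "\<tau> = {(v, b)}" | "\<tau> = {(a, v), (v, b)}" | "\<tau> = {(a, v)}" | "\<tau> = {(a, v), (b, v)}"
        using assms by (auto simp: extensions_def edge_iff cross_def)
      then show ?thesis
      proof cases
        case 1 then show ?thesis using \<open>y $ a < y $ b\<close> by (intro exI[of _ "y $ a - 1"]) auto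
      next
        case 2 then show ?thesis using \<open>y $ a < y $ b\<close> by (intro exI[of _ "y $ a"]) auto
      next
        case 3 then show ?thesis using \<open>y $ a < y $ b\<close> by (intro exI[of _ "(y $ a + y $ b) / 2"]) auto
      next
        case 4 then show ?thesis using \<open>y $ a < y $ b\<close> by (intro exI[of _ "y $ b"]) auto
      next
        case 5 then show ?thesis using \<open>y $ a < y $ b\<close> by (intro exI[of _ "y $ b + 1"]) auto
      qed
    next
      case 2
      then consider "\<tau> = {(v, b), (v, a)}" | "\<tau> = {(v, a)}" | "\<tau> = {(b, v), (v, a)}" | "\<tau> = {(b, v)}" | "\<tau> = {(b, v), (a, v)}"
        using assms by (auto simp: extensions_def edge_iff cross_def)
      then show ?thesis
      proof cases
        case 1 then show ?thesis using \<open>y $ b < y $ a\<close> by (intro exI[of _ "y $ b - 1"]) auto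
      next
        case 2 then show ?thesis using \<open>y $ b < y $ a\<close> by (intro exI[of _ "y $ b"]) auto
      next
        case 3 then show ?thesis using \<open>y $ b < y $ a\<close> by (intro exI[of _ "(y $ b + y $ a) / 2"]) auto
      next
        case 4 then show ?thesis using \<open>y $ b < y $ a\<close> by (intro exI[of _ "y $ a"]) auto
      next
        case 5 then show ?thesis using \<open>y $ b < y $ a\<close> by (intro exI[of _ "y $ a + 1"]) auto
      qed
    next
      case 3
      then consider "\<tau> = {}" | "\<tau> = {(v, a), (v, b)}" | "\<tau> = {(a, v), (b, v)}"
        using assms by (auto simp: extensions_def edge_iff)
      then show ?thesis
      proof cases
        case 1 then show ?thesis using 3 by (intro exI[of _ "y $ a"]) auto
      next
        case 2 then show ?thesis using 3 by (intro exI[of _ "y $ a - 1"]) auto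
      next
        case 3 then show ?thesis using \<open>y $ a = y $ b\<close> by (intro exI[of _ "y $ a + 1"]) auto
      qed
    qed
  qed
  with * that show thesis by blast
qed

lemma range_covector_ear:
  "range (covector E') = (\<lambda>(\<sigma>, \<tau>). \<sigma> \<union> \<tau>) ` (SIGMA \<sigma>:range (covector E). extensions \<sigma> a b v)"
proof (intro equalityI subsetI)
  fix \<rho> assume "\<rho> \<in> range (covector E')"
  then obtain y where "\<rho> = covector E y \<union> covector {{a, v}, {b, v}} y"
    by (auto simp: covector_E')
  then show "\<rho> \<in> (\<lambda>(\<sigma>, \<tau>). \<sigma> \<union> \<tau>) ` (SIGMA \<sigma>:range (covector E). extensions \<sigma> a b v)"
    using covector_star_in by (intro image_eqI[of _ _ "(covector E y, covector {{a, v}, {b, v}} y)"]) auto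
next
  fix \<rho> assume "\<rho> \<in> (\<lambda>(\<sigma>, \<tau>). \<sigma> \<union> \<tau>) ` (SIGMA \<sigma>:range (covector E). extensions \<sigma> a b v)"
  then obtain y \<tau> where 1: "\<tau> \<in> extensions (covector E y) a b v" "\<rho> = covector E y \<union> \<tau>" by auto
  obtain z where "covector E z = covector E y" "covector {{a, v}, {b, v}} z = \<tau>"
    using extension_realised[OF 1(1)] .
  then have "\<rho> = covector E' z" using 1 by (simp add: covector_E')
  then show "\<rho> \<in> range (covector E')" by simp
qed

lemma covector_sub: "\<sigma> \<in> range (covector E) \<Longrightarrow> \<sigma> \<subseteq> V \<times> V"
  using E_sub by (auto simp: covector_def)

lemma extensions_sub: "\<tau> \<in> extensions \<sigma> a b v \<Longrightarrow> \<tau> \<subseteq> {(a, v), (v, a), (b, v), (v, b)}"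
  by (auto simp: extensions_def cross_def split: if_splits)

lemma inj_on_union_extensions:
  "inj_on (\<lambda>(\<sigma>, \<tau>). \<sigma> \<union> \<tau>) (SIGMA \<sigma>:range (covector E). extensions \<sigma> a b v)"
proof (rule inj_on_inverseI[where g = "\<lambda>\<rho>. (\<rho> \<inter> V \<times> V, \<rho> - V \<times> V)"])
  fix p assume "p \<in> (SIGMA \<sigma>:range (covector E). extensions \<sigma> a b v)"
  then obtain \<sigma> \<tau> where "p = (\<sigma>, \<tau>)" "\<sigma> \<subseteq> V \<times> V" "\<tau> \<subseteq> {(a, v), (v, a), (b, v), (v, b)}"
    using covector_sub extensions_sub by (metis SigmaE)
  then show "((case p of (\<sigma>, \<tau>) \<Rightarrow> \<sigma> \<union> \<tau>) \<inter> V \<times> V, (case p of (\<sigma>, \<tau>) \<Rightarrow> \<sigma> \<union> \<tau>) - V \<times> V) = p"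
    using v by auto
qed

section \<open>Rank of the zero edges after attaching an ear\<close>

definition tied :: "('n \<times> 'n) set \<Rightarrow> 'n \<Rightarrow> bool" where
  "tied \<tau> c \<longleftrightarrow> (c, v) \<notin> \<tau> \<and> (v, c) \<notin> \<tau>"

lemma zero_vectors_ear:
  assumes "\<sigma> \<in> range (covector E)" "\<tau> \<in> extensions \<sigma> a b v"
  shows "zero_vectors E' (\<sigma> \<union> \<tau>) = zero_vectors E \<sigma> \<union>
     {x. \<exists>c\<in>{a, b}. tied \<tau> c \<and> (x = axis c 1 - axis v 1 \<or> x = axis v 1 - axis c 1)}"
proof -
  have *: "(i, j) \<notin> \<sigma> \<union> \<tau> \<longleftrightarrow> (i, j) \<notin> \<sigma>" if "{i, j} \<in> E" for i j
  proof -
    have "i \<noteq> v" "j \<noteq> v" using that E_sub v by auto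
    then show ?thesis using extensions_sub[OF assms(2)] by auto
  qed
  have **: "(v, j) \<notin> \<sigma>" "(j, v) \<notin> \<sigma>" for j using covector_sub[OF assms(1)] v by auto
  have sw: "{i, j} \<in> E \<Longrightarrow> {j, i} \<in> E" for i j by (simp add: insert_commute)
  have split: "{axis i 1 - axis j 1 | i j. ({i, j} \<in> E \<or> (\<exists>c\<in>{a,b}. {i, j} = {c, v})) \<and> (i, j) \<notin> \<sigma> \<union> \<tau> \<and> (j, i) \<notin> \<sigma> \<union> \<tau>} =
     {axis i 1 - axis j 1 | i j. {i, j} \<in> E \<and> (i, j) \<notin> \<sigma> \<union> \<tau> \<and> (j, i) \<notin> \<sigma> \<union> \<tau>} \<union>
     {x :: real^'n. \<exists>c\<in>{a,b}. \<exists>i j. x = axis i 1 - axis j 1 \<and> {i, j} = {c, v} \<and> (i, j) \<notin> \<sigma> \<union> \<tau> \<and> (j, i) \<notin> \<sigma> \<union> \<tau>}"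
    by blast
  have 1: "{axis i 1 - axis j 1 :: real^'n | i j. {i, j} \<in> E \<and> (i, j) \<notin> \<sigma> \<union> \<tau> \<and> (j, i) \<notin> \<sigma> \<union> \<tau>} = zero_vectors E \<sigma>"
    unfolding zero_vectors_def using * sw by blast
  have 2: "(\<exists>i j. x = axis i 1 - axis j 1 \<and> {i, j} = {c, v} \<and> (i, j) \<notin> \<sigma> \<union> \<tau> \<and> (j, i) \<notin> \<sigma> \<union> \<tau>) \<longleftrightarrow>
      tied \<tau> c \<and> (x = axis c 1 - axis v 1 \<or> x = axis v 1 - axis c 1)" for c and x :: "real^'n"
    unfolding doubleton_eq_iff tied_def using ** by blast
  have "zero_vectors E' (\<sigma> \<union> \<tau>) = {axis i 1 - axis j 1 | i j. ({i, j} \<in> E \<or> (\<exists>c\<in>{a,b}. {i, j} = {c, v})) \<and> (i, j) \<notin> \<sigma> \<union> \<tau> \<and> (j, i) \<notin> \<sigma> \<union> \<tau>}"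
    unfolding zero_vectors_def E'_def by blast
  then show ?thesis unfolding split 1 2 .
qed

lemma span_zero_vectors_coordinate:
  assumes "x \<in> span (zero_vectors E \<sigma>)"
  shows "x $ v = 0"
proof -
  have "span (zero_vectors E \<sigma>) \<subseteq> {x. x $ v = 0}"
  proof (rule span_minimal)
    show "zero_vectors E \<sigma> \<subseteq> {x. x $ v = 0}"
    proof
      fix x assume "x \<in> zero_vectors E \<sigma>"
      then obtain i j where "x = axis i 1 - axis j 1" "{i, j} \<in> E" by (auto simp: zero_vectors_def)
      then show "x \<in> {x. x $ v = 0}" using E_sub v by (auto simp: axis_def)
    qed
    show "subspace {x :: real^'n. x $ v = 0}" by (auto simp: subspace_def)
  qed
  then show ?thesis using assms by auto
qed

text \<open>Keeps the natural subtraction in the exponents of \<open>covector_poly\<close> from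
  truncating.\<close>

lemma dim_zero_vectors_le: "dim (zero_vectors E \<sigma>) \<le> card V"
proof -
  have "dim (zero_vectors E \<sigma>) \<le> card ((\<lambda>i. axis i 1 :: real^'n) ` V)"
  proof (rule dim_le_card)
    show "zero_vectors E \<sigma> \<subseteq> span ((\<lambda>i. axis i 1) ` V)"
    proof
      fix x assume "x \<in> zero_vectors E \<sigma>"
      then obtain i j where "x = axis i 1 - axis j 1" "{i, j} \<in> E" by (auto simp: zero_vectors_def)
      then show "x \<in> span ((\<lambda>i. axis i 1) ` V)"
        using E_sub by (auto intro: span_diff[OF span_base span_base])
    qed
  qed simp
  also have "\<dots> \<le> card V" by (rule card_image_le) simp
  finally show ?thesis .
qed

text \<open>The vector of a tied new edge has a nonzero coordinate at \<open>v\<close>, so it leaves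
  the old span. If both new edges are tied, then \<open>a = b\<close> or \<open>{a, b}\<close> has
  sign zero, and the second vector depends on the first and the old ones.\<close>

lemma dim_zero_vectors_ear:
  assumes "\<sigma> \<in> range (covector E)" "\<tau> \<in> extensions \<sigma> a b v"
  shows "dim (zero_vectors E' (\<sigma> \<union> \<tau>)) =
    (if tied \<tau> a \<or> tied \<tau> b then Suc (dim (zero_vectors E \<sigma>)) else dim (zero_vectors E \<sigma>))"
proof (cases "tied \<tau> a \<or> tied \<tau> b")
  case True
  then obtain c where c: "c \<in> {a, b}" "tied \<tau> c" by auto
  define u :: "real^'n" where "u = axis v 1 - axis c 1"
  have u: "u $ v \<noteq> 0" using c neq by (auto simp: u_def axis_def)
  have other: "axis v 1 - axis d 1 \<in> span (insert u (zero_vectors E \<sigma>))" if d: "d \<in> {a, b}" "tied \<tau> d" for d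
  proof (cases "d = c")
    case False
    then have dc: "{d, c} = {a, b}" "a \<noteq> b" using c d by auto
    then have "{d, c} \<in> E" using ab_edge by auto
    \<comment> \<open>Each of the sign patterns in \<open>cross\<close> leaves at most one new edge
      tied.\<close>
    have "(a, b) \<notin> \<sigma> \<and> (b, a) \<notin> \<sigma>"
    proof (rule ccontr)
      assume "\<not> ?thesis"
      then have "\<tau> \<in> cross a b v \<or> \<tau> \<in> cross b a v" using assms(2) by (auto simp: extensions_def split: if_splits)
      moreover have "tied \<tau> a" "tied \<tau> b" using c d dc by (auto simp: doubleton_eq_iff)
      ultimately show False unfolding tied_def by (auto simp: cross_def)
    qed
    then have "(d, c) \<notin> \<sigma> \<and> (c, d) \<notin> \<sigma>" using dc by (auto simp: doubleton_eq_iff)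
    then have "axis d 1 - axis c 1 \<in> zero_vectors E \<sigma>"
      using \<open>{d, c} \<in> E\<close> by (auto simp: zero_vectors_def)
    then have "u - (axis d 1 - axis c 1) \<in> span (insert u (zero_vectors E \<sigma>))"
      by (intro span_diff span_base) auto
    then show ?thesis by (simp add: u_def)
  qed (simp add: u_def span_base)
  have "u \<in> zero_vectors E' (\<sigma> \<union> \<tau>)"
    unfolding zero_vectors_ear[OF assms] u_def using c by blast
  moreover have "x \<in> span (insert u (zero_vectors E \<sigma>))" if "x \<in> zero_vectors E' (\<sigma> \<union> \<tau>)" for x
  proof -
    from that consider "x \<in> zero_vectors E \<sigma>"
      | d where "d \<in> {a, b}" "tied \<tau> d" "x = axis v 1 - axis d 1 \<or> x = - (axis v 1 - axis d 1)"
      unfolding zero_vectors_ear[OF assms] by fastforce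
    then show ?thesis
      by cases (auto intro: span_base other span_neg simp del: minus_diff_eq)
  qed
  moreover have "zero_vectors E \<sigma> \<subseteq> zero_vectors E' (\<sigma> \<union> \<tau>)"
    unfolding zero_vectors_ear[OF assms] by blast
  ultimately have "span (zero_vectors E' (\<sigma> \<union> \<tau>)) = span (insert u (zero_vectors E \<sigma>))"
    unfolding span_eq by (auto intro: span_base)
  then have "dim (zero_vectors E' (\<sigma> \<union> \<tau>)) = dim (insert u (zero_vectors E \<sigma>))"
    by (metis dim_span)
  also have "\<dots> = Suc (dim (zero_vectors E \<sigma>))"
    unfolding dim_insert using u span_zero_vectors_coordinate by auto
  finally show ?thesis using True by simp
next
  case False
  then have "zero_vectors E' (\<sigma> \<union> \<tau>) = zero_vectors E \<sigma>"
    unfolding zero_vectors_ear[OF assms] by auto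
  with False show ?thesis by simp
qed

section \<open>Weighted counts of extensions\<close>

lemma sum_cross:
  fixes f :: "_ \<Rightarrow> 'c::comm_monoid_add"
  assumes "a \<noteq> b"
  shows "sum f (cross a b v) =
    f {(v, a), (v, b)} + (f {(v, b)} + (f {(a, v), (v, b)} + (f {(a, v)} + f {(a, v), (b, v)})))"
    "sum f (cross b a v) =
    f {(v, b), (v, a)} + (f {(v, a)} + (f {(b, v), (v, a)} + (f {(b, v)} + f {(b, v), (a, v)})))"
  using assms neq unfolding cross_def by (auto simp: doubleton_eq_iff singleton_insert_inj_eq singleton_insert_inj_eq')

lemma irrefl_covector: "\<sigma> \<in> range (covector E) \<Longrightarrow> (c, c) \<notin> \<sigma>"
  by (auto simp: covector_def)

abbreviation level :: "('n \<times> 'n) set \<Rightarrow> bool" where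
  "level \<sigma> \<equiv> (a, b) \<notin> \<sigma> \<and> (b, a) \<notin> \<sigma>"

text \<open>The new vertex raises \<open>card V\<close> by one, so an extension keeps the weight if
  the rank rises too and gains a factor \<open>t\<close> otherwise. One of the three extensions of a
  level covector raises the rank, and two of the five extensions of any other.\<close>

lemma sum_extensions:
  fixes w :: "int poly"
  assumes "\<sigma> \<in> range (covector E)"
  shows "(\<Sum>\<tau>\<in>extensions \<sigma> a b v. if tied \<tau> a \<or> tied \<tau> b then w else [:0, 1:] * w) =
    (if level \<sigma> then [:1, 2:] * w else [:2, 3:] * w)"
proof -
  have *: "[:1, 2:] = 1 + 2 * [:0, 1 :: int:]" "[:2, 3:] = 2 + 3 * [:0, 1 :: int:]"
    by (simp_all add: numeral_poly one_pCons)
  consider "(a, b) \<in> \<sigma>" "a \<noteq> b" | "(b, a) \<in> \<sigma>" "(a, b) \<notin> \<sigma>" "a \<noteq> b" | "level \<sigma>"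
    using irrefl_covector[OF assms] by blast
  then show ?thesis
  proof cases
    case 1
    then have "extensions \<sigma> a b v = cross a b v" by (simp add: extensions_def)
    then show ?thesis unfolding * using 1 neq
      by (simp add: sum_cross tied_def algebra_simps del: mult_pCons_left mult_pCons_right)
  next
    case 2
    then have "extensions \<sigma> a b v = cross b a v" by (simp add: extensions_def)
    then show ?thesis unfolding * using 2 neq
      by (simp add: sum_cross tied_def algebra_simps del: mult_pCons_left mult_pCons_right)
  next
    case 3
    then have "extensions \<sigma> a b v = {{}, {(v, a), (v, b)}, {(a, v), (b, v)}}" by (simp add: extensions_def)
    then show ?thesis unfolding * using 3 neq
      by (auto simp: tied_def algebra_simps doubleton_eq_iff simp del: mult_pCons_left mult_pCons_right)
  qed
qed

lemma cross_tied:
  assumes "a \<noteq> b"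
  shows "{\<tau> \<in> cross a b v. tied \<tau> a} = {{(v, b)}}" "{\<tau> \<in> cross a b v. tied \<tau> b} = {{(a, v)}}"
    "{\<tau> \<in> cross b a v. tied \<tau> a} = {{(b, v)}}" "{\<tau> \<in> cross b a v. tied \<tau> b} = {{(v, a)}}"
  using assms neq unfolding cross_def tied_def by auto

text \<open>A zero on \<open>{c, v}\<close> forces the value at \<open>v\<close> to be that at
  \<open>c\<close>, which leaves a single position.\<close>

lemma extensions_tied:
  assumes "\<sigma> \<in> range (covector E)" "c \<in> {a, b}"
  obtains \<tau> where "{\<tau> \<in> extensions \<sigma> a b v. tied \<tau> c} = {\<tau>}"
proof -
  have "\<exists>\<tau>. {\<tau> \<in> extensions \<sigma> a b v. tied \<tau> c} = {\<tau>}"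
  proof (cases "level \<sigma>")
    case True
    then have "{\<tau> \<in> extensions \<sigma> a b v. tied \<tau> c} = {{}}"
      using assms(2) by (auto simp: extensions_def tied_def)
    then show ?thesis by blast
  next
    case False
    then have "a \<noteq> b" using irrefl_covector[OF assms(1)] by auto
    then show ?thesis
      using assms(2) False by (auto simp: extensions_def cross_tied)
  qed
  with that show thesis by blast
qed

lemma extensions_tied_both:
  assumes "\<sigma> \<in> range (covector E)"
  shows "{\<tau> \<in> extensions \<sigma> a b v. tied \<tau> a \<and> tied \<tau> b} = (if level \<sigma> then {{}} else {})"
  using neq by (auto simp: extensions_def tied_def cross_def)

lemma vanishing_level:
  "vanishing E (insert {a, b} S) = {\<sigma> \<in> vanishing E S. level \<sigma>}"
  unfolding vanishing_def by (auto simp: doubleton_eq_iff)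

lemma finite_vanishing: "finite (vanishing F S)"
  by (rule finite_subset[OF subset_UNIV]) simp

text \<open>Common form of the next three lemmas: \<open>T\<close> selects the new edges that must
  vanish. The condition splits into one on \<open>\<sigma>\<close> given by \<open>S\<close> and one
  on \<open>\<tau>\<close> given by \<open>T\<close>.\<close>

lemma covector_poly_ear:
  assumes S: "\<Union>S \<subseteq> V" and T: "T \<subseteq> {a, b}"
  shows "covector_poly (insert v V) E' (S \<union> (\<lambda>c. {c, v}) ` T) =
    (\<Sum>\<sigma>\<in>vanishing E S. \<Sum>\<tau>\<in>{\<tau> \<in> extensions \<sigma> a b v. \<forall>c\<in>T. tied \<tau> c}.
       if tied \<tau> a \<or> tied \<tau> b then monom 1 (card V - dim (zero_vectors E \<sigma>))
       else [:0, 1:] * monom 1 (card V - dim (zero_vectors E \<sigma>)))"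
    (is "_ = (\<Sum>\<sigma>\<in>_. \<Sum>\<tau>\<in>?X \<sigma>. ?w \<sigma> \<tau>)")
proof -
  have ok: "(\<forall>(i, j)\<in>\<sigma> \<union> \<tau>. {i, j} \<notin> S \<union> (\<lambda>c. {c, v}) ` T) \<longleftrightarrow>
      (\<forall>(i, j)\<in>\<sigma>. {i, j} \<notin> S) \<and> (\<forall>c\<in>T. tied \<tau> c)"
    if "\<sigma> \<in> range (covector E)" "\<tau> \<in> extensions \<sigma> a b v" for \<sigma> \<tau>
  proof -
    have "\<forall>(i, j)\<in>\<sigma>. i \<noteq> v \<and> j \<noteq> v" using covector_sub[OF that(1)] v by auto
    moreover have "(\<forall>(i, j)\<in>\<tau>. {i, j} \<notin> S \<union> (\<lambda>c. {c, v}) ` T) \<longleftrightarrow> (\<forall>c\<in>T. tied \<tau> c)"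
    proof -
      have "{i, j} \<notin> S" if "(i, j) \<in> \<tau>" for i j
        using extensions_sub[OF \<open>\<tau> \<in> _\<close>] that S v by blast
      moreover have "(\<forall>(i, j)\<in>\<tau>. {i, j} \<notin> (\<lambda>c. {c, v}) ` T) \<longleftrightarrow> (\<forall>c\<in>T. tied \<tau> c)"
        unfolding tied_def image_iff Ball_def split_paired_All case_prod_conv Bex_def doubleton_eq_iff
        by blast
      ultimately show ?thesis by blast
    qed
    ultimately show ?thesis by (fastforce simp: doubleton_eq_iff)
  qed
  have eq: "vanishing E' (S \<union> (\<lambda>c. {c, v}) ` T) = (\<lambda>(\<sigma>, \<tau>). \<sigma> \<union> \<tau>) ` (SIGMA \<sigma>:vanishing E S. ?X \<sigma>)"
    (is "?L = ?R")
  proof -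
    have "?L = {\<rho> \<in> (\<lambda>(\<sigma>, \<tau>). \<sigma> \<union> \<tau>) ` (SIGMA \<sigma>:range (covector E). extensions \<sigma> a b v).
        \<forall>(i, j)\<in>\<rho>. {i, j} \<notin> S \<union> (\<lambda>c. {c, v}) ` T}"
      unfolding vanishing_def range_covector_ear ..
    also have "\<dots> = (\<lambda>(\<sigma>, \<tau>). \<sigma> \<union> \<tau>) ` {p \<in> (SIGMA \<sigma>:range (covector E). extensions \<sigma> a b v).
        \<forall>(i, j)\<in>(case p of (\<sigma>, \<tau>) \<Rightarrow> \<sigma> \<union> \<tau>). {i, j} \<notin> S \<union> (\<lambda>c. {c, v}) ` T}"
      by (rule Compr_image_eq)
    also have "{p \<in> (SIGMA \<sigma>:range (covector E). extensions \<sigma> a b v).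
        \<forall>(i, j)\<in>(case p of (\<sigma>, \<tau>) \<Rightarrow> \<sigma> \<union> \<tau>). {i, j} \<notin> S \<union> (\<lambda>c. {c, v}) ` T} = (SIGMA \<sigma>:vanishing E S. ?X \<sigma>)"
    proof (rule set_eqI)
      fix p :: "('n \<times> 'n) set \<times> ('n \<times> 'n) set"
      obtain \<sigma> \<tau> where p: "p = (\<sigma>, \<tau>)" by fastforce
      show "p \<in> {p \<in> (SIGMA \<sigma>:range (covector E). extensions \<sigma> a b v).
        \<forall>(i, j)\<in>(case p of (\<sigma>, \<tau>) \<Rightarrow> \<sigma> \<union> \<tau>). {i, j} \<notin> S \<union> (\<lambda>c. {c, v}) ` T} \<longleftrightarrow> p \<in> (SIGMA \<sigma>:vanishing E S. ?X \<sigma>)"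
        unfolding p mem_Collect_eq mem_Sigma_iff case_prod_conv vanishing_def
        using ok[of \<sigma> \<tau>] by blast
    qed
    finally show ?thesis .
  qed
  have inj: "inj_on (\<lambda>(\<sigma>, \<tau>). \<sigma> \<union> \<tau>) (SIGMA \<sigma>:vanishing E S. ?X \<sigma>)"
    by (rule inj_on_subset[OF inj_on_union_extensions]) (auto simp: vanishing_def)
  have w: "monom 1 (card (insert v V) - dim (zero_vectors E' (\<sigma> \<union> \<tau>))) = ?w \<sigma> \<tau>"
    if "\<sigma> \<in> vanishing E S" "\<tau> \<in> ?X \<sigma>" for \<sigma> \<tau>
    using that v dim_zero_vectors_ear[of \<sigma> \<tau>] dim_zero_vectors_le[of \<sigma>]
    by (simp add: vanishing_def Suc_diff_le monom_Suc)
  have "covector_poly (insert v V) E' (S \<union> (\<lambda>c. {c, v}) ` T) =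
     (\<Sum>(\<sigma>, \<tau>)\<in>(SIGMA \<sigma>:vanishing E S. ?X \<sigma>). monom 1 (card (insert v V) - dim (zero_vectors E' (\<sigma> \<union> \<tau>))))"
    unfolding covector_poly_def eq sum.reindex[OF inj] by (simp add: case_prod_beta)
  also have "\<dots> = (\<Sum>\<sigma>\<in>vanishing E S. \<Sum>\<tau>\<in>?X \<sigma>. monom 1 (card (insert v V) - dim (zero_vectors E' (\<sigma> \<union> \<tau>))))"
    by (rule sum.Sigma [symmetric]) (auto simp: finite_vanishing)
  also have "\<dots> = (\<Sum>\<sigma>\<in>vanishing E S. \<Sum>\<tau>\<in>?X \<sigma>. ?w \<sigma> \<tau>)"
    by (intro sum.cong refl w)
  finally show ?thesis .
qed

text \<open>Giving every covector the factor \<open>2 + 3 t\<close> overcounts those vanishing on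
  \<open>{a, b}\<close>, whose factor is \<open>1 + 2 t\<close>, by \<open>1 + t\<close>.\<close>

lemma covector_poly_ear_none:
  assumes "\<Union>S \<subseteq> V"
  shows "covector_poly (insert v V) E' S =
    [:2, 3:] * covector_poly V E S - [:1, 1:] * covector_poly V E (insert {a, b} S)"
proof -
  let ?w = "\<lambda>\<sigma>. monom (1::int) (card V - dim (zero_vectors E \<sigma>))"
  have "covector_poly (insert v V) E' S =
      (\<Sum>\<sigma>\<in>vanishing E S. if level \<sigma> then [:1, 2:] * ?w \<sigma> else [:2, 3:] * ?w \<sigma>)"
    using covector_poly_ear[OF assms, of "{}"]
    by (simp add: sum_extensions vanishing_def del: mult_pCons_left mult_pCons_right)
  also have "\<dots> = (\<Sum>\<sigma>\<in>vanishing E S. [:2, 3:] * ?w \<sigma> - [:1, 1:] * (if level \<sigma> then ?w \<sigma> else 0))"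
    by (rule sum.cong) (simp_all add: left_diff_distrib [symmetric] del: mult_pCons_left mult_pCons_right)
  also have "\<dots> = [:2, 3:] * covector_poly V E S - [:1, 1:] * covector_poly V E (insert {a, b} S)"
    unfolding covector_poly_def vanishing_level sum_subtractf sum_distrib_left [symmetric]
    by (simp add: sum.inter_filter finite_vanishing del: mult_pCons_left mult_pCons_right)
  finally show ?thesis .
qed

text \<open>Contracting \<open>{c, v}\<close> undoes the ear: the extension is unique, and vertex
  number and rank both rise by one.\<close>

lemma covector_poly_ear_one:
  assumes "\<Union>S \<subseteq> V" "c \<in> {a, b}"
  shows "covector_poly (insert v V) E' (insert {c, v} S) = covector_poly V E S"
proof -
  have "covector_poly (insert v V) E' (insert {c, v} S) =
    (\<Sum>\<sigma>\<in>vanishing E S. \<Sum>\<tau>\<in>{\<tau> \<in> extensions \<sigma> a b v. tied \<tau> c}.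
       if tied \<tau> a \<or> tied \<tau> b then monom 1 (card V - dim (zero_vectors E \<sigma>))
       else [:0, 1:] * monom 1 (card V - dim (zero_vectors E \<sigma>)))"
    using covector_poly_ear[OF assms(1), of "{c}"] assms(2) by simp
  also have "\<dots> = covector_poly V E S"
    unfolding covector_poly_def
  proof (rule sum.cong)
    fix \<sigma> assume "\<sigma> \<in> vanishing E S"
    then have "\<sigma> \<in> range (covector E)" by (simp add: vanishing_def)
    from extensions_tied[OF this assms(2)]
    obtain \<tau> where \<tau>: "{\<tau> \<in> extensions \<sigma> a b v. tied \<tau> c} = {\<tau>}" .
    then have "tied \<tau> c" by blast
    then show "(\<Sum>\<tau>\<in>{\<tau> \<in> extensions \<sigma> a b v. tied \<tau> c}.
       if tied \<tau> a \<or> tied \<tau> b then monom 1 (card V - dim (zero_vectors E \<sigma>))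
       else [:0, 1:] * monom 1 (card V - dim (zero_vectors E \<sigma>))) =
       monom 1 (card V - dim (zero_vectors E \<sigma>))"
      unfolding \<tau> using assms(2) by auto
  qed simp
  finally show ?thesis .
qed

text \<open>Zeros on both new edges make the values at \<open>a\<close>, \<open>b\<close> and
  \<open>v\<close> equal, so the old covector must vanish on \<open>{a, b}\<close>.\<close>

lemma covector_poly_ear_both:
  assumes "\<Union>S \<subseteq> V"
  shows "covector_poly (insert v V) E' (insert {a, v} (insert {b, v} S)) = covector_poly V E (insert {a, b} S)"
proof -
  have "covector_poly (insert v V) E' (insert {a, v} (insert {b, v} S)) =
    (\<Sum>\<sigma>\<in>vanishing E S. \<Sum>\<tau>\<in>{\<tau> \<in> extensions \<sigma> a b v. tied \<tau> a \<and> tied \<tau> b}.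
       if tied \<tau> a \<or> tied \<tau> b then monom 1 (card V - dim (zero_vectors E \<sigma>))
       else [:0, 1:] * monom 1 (card V - dim (zero_vectors E \<sigma>)))"
    using covector_poly_ear[OF assms(1), of "{a, b}"] by (simp add: insert_commute)
  also have "\<dots> = (\<Sum>\<sigma>\<in>vanishing E S. if level \<sigma> then monom 1 (card V - dim (zero_vectors E \<sigma>)) else 0)"
  proof (rule sum.cong)
    fix \<sigma> assume "\<sigma> \<in> vanishing E S"
    then have "\<sigma> \<in> range (covector E)" by (simp add: vanishing_def)
    then show "(\<Sum>\<tau>\<in>{\<tau> \<in> extensions \<sigma> a b v. tied \<tau> a \<and> tied \<tau> b}.
       if tied \<tau> a \<or> tied \<tau> b then monom 1 (card V - dim (zero_vectors E \<sigma>))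
       else [:0, 1:] * monom 1 (card V - dim (zero_vectors E \<sigma>))) =
       (if level \<sigma> then monom 1 (card V - dim (zero_vectors E \<sigma>)) else 0)"
      unfolding extensions_tied_both[OF \<open>\<sigma> \<in> range _\<close>] by (simp add: tied_def)
  qed simp
  also have "\<dots> = covector_poly V E (insert {a, b} S)"
    unfolding covector_poly_def vanishing_level by (simp add: sum.inter_filter finite_vanishing)
  finally show ?thesis .
qed

end

section \<open>Gluing triangles\<close>

text \<open>
  \<open>B\<close> collects the boundary edges of the polygon.  It is a multiset so that the induction can start
  at a single vertex \<open>a\<close>, a one-gon whose boundary edge is the loop \<open>{a}\<close>, and pass through the
  two-gon, whose only edge is twice on the boundary.  Requiring zeros on \<open>S\<close> amounts to contracting
  \<open>S\<close>, which yields a smaller polygon; without this generality the induction does not go through.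
\<close>

definition stack_count :: "'n set \<Rightarrow> 'n set set \<Rightarrow> 'n::finite set multiset \<Rightarrow> bool" where
  "stack_count V E B \<longleftrightarrow> \<Union>E \<subseteq> V \<and> size B = card V \<and>
     (\<forall>e\<in>#B. e \<subseteq> V \<and> (is_singleton e \<or> e \<in> E)) \<and>
     (\<forall>S. S \<subseteq># B \<longrightarrow> covector_poly V E (set_mset S) = stack_poly (card V - size S))"

lemma stack_count_vertex:
  fixes a :: "'n::finite"
  shows "stack_count {a} {} {#{a}#}"
proof -
  have "vanishing {} S = {{}}" for S :: "'n set set"
    unfolding vanishing_def covector_def by auto
  then have "covector_poly {a} {} S = [:0, 1:]" for S
    by (simp add: covector_poly_def zero_vectors_def monom_Suc)
  \<comment> \<open>Here \<open>S\<close> is empty or the whole boundary, so both initial values of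
    \<open>stack_poly\<close> occur.\<close>
  moreover have "stack_poly (Suc 0 - k) = [:0, 1:]" for k
    by (cases k) simp_all
  ultimately show ?thesis
    unfolding stack_count_def by auto
qed

lemma subset_add_mset_cases:
  assumes "S \<subseteq># add_mset x M"
  shows "S \<subseteq># M \<or> (\<exists>T. T \<subseteq># M \<and> S = add_mset x T)"
proof (cases "x \<in># S")
  case True
  then obtain T where "S = add_mset x T" by (rule mset_add)
  with assms show ?thesis by auto
next
  case False
  with assms have "S \<subseteq># M" by (simp add: subseteq_mset_def not_in_iff) (metis le0)
  then show ?thesis ..
qed

text \<open>The set \<open>S\<close> splits into old boundary edges \<open>S1\<close> and some of
  the two new edges. As one copy of \<open>{a, b}\<close> has left the boundary, \<open>S1\<close>
  together with \<open>{a, b}\<close> is still contained in \<open>B\<close>, and the hypothesis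
  applies to both.\<close>

lemma stack_count_ear:
  assumes count: "stack_count V E B" and abB: "{a, b} \<in># B" and vV: "v \<notin> V"
  shows "stack_count (insert v V) (insert {a, v} (insert {b, v} E)) (B - {#{a, b}#} + {#{a, v}, {b, v}#})"
proof -
  have B: "\<And>e. e \<in># B \<Longrightarrow> e \<subseteq> V \<and> (is_singleton e \<or> e \<in> E)"
    and poly: "\<And>S. S \<subseteq># B \<Longrightarrow> covector_poly V E (set_mset S) = stack_poly (card V - size S)"
    and size: "size B = card V" and E: "\<Union>E \<subseteq> V"
    using count by (simp_all add: stack_count_def)
  have "a = b \<or> {a, b} \<in> E"
    using B[OF abB] by (metis is_singletonE insertCI singletonD)
  then interpret ear V E a b v
    using B[OF abB] E vV by unfold_locales blast+
  define C where "C = B - {#{a, b}#}"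
  have BC: "B = add_mset {a, b} C" by (simp add: C_def insert_DiffM[OF abB])
  have C_sub: "\<Union>(set_mset S) \<subseteq> V" if "S \<subseteq># C" for S
  proof -
    have "e \<subseteq> V" if "e \<in># S" for e
      using B[of e] mset_subset_eqD[OF \<open>S \<subseteq># C\<close> that] by (simp add: BC)
    then show ?thesis by blast
  qed
  have count': "covector_poly (insert v V) E' (set_mset S) = stack_poly (card (insert v V) - size S)"
    if S: "S \<subseteq># C + {#{a, v}, {b, v}#}" for S
  proof -
    obtain S1 S2 where S12: "S = S1 + S2" "S1 \<subseteq># C" "S2 \<subseteq># {#{a, v}, {b, v}#}"
    proof (rule that)
      show "S = (S \<inter># C) + (S - C)" by (rule multiset_eqI) simp
      show "S - C \<subseteq># {#{a, v}, {b, v}#}" using S by (simp add: subset_eq_diff_conv add.commute)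
    qed simp
    have S1: "S1 \<subseteq># B" "add_mset {a, b} S1 \<subseteq># B" using S12 by (auto simp: BC intro: subset_mset.order_trans)
    \<comment> \<open>This bound keeps the index of \<open>stack_poly\<close> from truncating, so
      that its recursion equation applies.\<close>
    have szle: "Suc (size S1) \<le> card V" using size_mset_mono[OF S1(2)] size by simp
    have sub: "\<Union>(set_mset S1) \<subseteq> V" using C_sub S12 by simp
    consider "S2 = {#}" | c where "c \<in> {a, b}" "S2 = {#{c, v}#}" | "S2 = {#{a, v}, {b, v}#}"
      using subset_add_mset_cases[OF S12(3)] subset_add_mset_cases[of _ "{b, v}" "{#}"] by force
    then show ?thesis
    proof cases
      case 1
      obtain k where k: "card V - size S1 = Suc k" "card V - Suc (size S1) = k"
        using szle by (metis Suc_diff_Suc Suc_le_lessD)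
      have "Suc (card V) - size S1 = Suc (Suc k)" using k szle by linarith
      then show ?thesis
        using covector_poly_ear_none[OF sub] poly[OF S1(1)] poly[OF S1(2)] k v
        by (simp add: S12 1)
    next
      case 2
      then show ?thesis
        using covector_poly_ear_one[OF sub 2(1)] poly[OF S1(1)] v by (simp add: S12)
    next
      case 3
      then show ?thesis
        using covector_poly_ear_both[OF sub] poly[OF S1(2)] v by (simp add: S12)
    qed
  qed
  show ?thesis
    unfolding stack_count_def
  proof (intro conjI ballI allI impI)
    show "\<Union>(insert {a, v} (insert {b, v} E)) \<subseteq> insert v V" using E_sub ab B[OF abB] by auto
    show "size (B - {#{a, b}#} + {#{a, v}, {b, v}#}) = card (insert v V)"
      using size v by (simp add: BC)
    show "covector_poly (insert v V) (insert {a, v} (insert {b, v} E)) (set_mset S) =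
        stack_poly (card (insert v V) - size S)"
      if "S \<subseteq># B - {#{a, b}#} + {#{a, v}, {b, v}#}" for S
      using count'[of S] that by (simp add: C_def E'_def)
    fix e assume "e \<in># B - {#{a, b}#} + {#{a, v}, {b, v}#}"
    then have e: "e \<in># B \<or> e = {a, v} \<or> e = {b, v}" by (auto dest: in_diffD)
    show "e \<subseteq> insert v V" using e B ear_axioms by (auto simp: ear_def)
    show "is_singleton e \<or> e \<in> insert {a, v} (insert {b, v} E)" using e B by auto
  qed
qed

definition clique_edges :: "'n set set \<Rightarrow> 'n set set" where
  "clique_edges K = {{i, j} | i j. i \<noteq> j \<and> (\<exists>t\<in>K. i \<in> t \<and> j \<in> t)}"

inductive glued :: "'n set set \<Rightarrow> 'n set multiset \<Rightarrow> bool" where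
  triangle: "a \<noteq> b \<Longrightarrow> a \<noteq> c \<Longrightarrow> b \<noteq> c \<Longrightarrow> glued {{a, b, c}} {#{a, b}, {a, c}, {b, c}#}"
| glue: "glued K B \<Longrightarrow> {a, b} \<in># B \<Longrightarrow> a \<noteq> b \<Longrightarrow> v \<notin> \<Union>K \<Longrightarrow>
    glued (insert {a, b, v} K) (B - {#{a, b}#} + {#{a, v}, {b, v}#})"

lemma stack_count_glued: "glued K B \<Longrightarrow> stack_count (\<Union>K) (clique_edges K) B"
proof (induction rule: glued.induct)
  case (triangle a b c)
  \<comment> \<open>The ear over the loop \<open>{a}\<close> yields the two-gon with
    \<open>{a, b}\<close> twice on its boundary; one copy then carries the triangle.\<close>
  have "stack_count {b, a} {{a, b}} {#{a, b}, {a, b}#}"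
    using stack_count_ear[OF stack_count_vertex[of a], of a a b] triangle by simp
  from stack_count_ear[OF this, of a b c] triangle
  have "stack_count {c, b, a} {{a, c}, {b, c}, {a, b}} {#{a, c}, {b, c}, {a, b}#}" by simp
  moreover have "{#{a, c}, {b, c}, {a, b}#} = {#{a, b}, {a, c}, {b, c}#}"
    by (rule multiset_eqI) simp
  moreover have "clique_edges {{a, b, c}} = {{a, c}, {b, c}, {a, b}}"
    using triangle by (auto simp: clique_edges_def)
  moreover have "\<Union>{{a, b, c}} = {c, b, a}" by auto
  ultimately show ?case by simp
next
  case (glue K B a b v)
  have E: "{a, b} \<subseteq> \<Union>K" "{a, b} \<in> clique_edges K"
    using glue by (auto simp: stack_count_def is_singleton_def doubleton_eq_iff)
  then have "clique_edges (insert {a, b, v} K) = insert {a, v} (insert {b, v} (clique_edges K))"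
    using glue.hyps unfolding clique_edges_def by (auto simp: doubleton_eq_iff; metis)
  moreover have "\<Union>(insert {a, b, v} K) = insert v (\<Union>K)" using E by auto
  ultimately show ?case using stack_count_ear[OF glue.IH glue.hyps(2) glue.hyps(4)] by simp
qed

section \<open>Faces of graphical zonotopes\<close>

lemma polytope_set_sum:
  fixes S :: "'i \<Rightarrow> 'a::euclidean_space set"
  assumes "\<And>i. i \<in> I \<Longrightarrow> polytope (S i)"
  shows "polytope (\<Sum>i\<in>I. S i)"
proof -
  obtain A where A: "\<And>i. i \<in> I \<Longrightarrow> finite (A i) \<and> S i = convex hull (A i)"
    using assms unfolding polytope_def by metis
  have "(\<Sum>i\<in>I. S i) = (\<Sum>i\<in>I. convex hull (A i))" using A by simp
  also have "\<dots> = convex hull (\<Sum>i\<in>I. A i)" by (simp add: convex_hull_set_sum)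
  finally have "(\<Sum>i\<in>I. S i) = convex hull (\<Sum>i\<in>I. A i)" .
  moreover have "finite (\<Sum>i\<in>I. A i)"
    using A by (induction I rule: infinite_finite_induct) (auto simp: set_plus_def intro: finite_set_plus)
  ultimately show ?thesis using polytope_convex_hull by metis
qed

text \<open>The slacks \<open>M i - y \<bullet> s i\<close> are nonnegative, so their sum is zero
  only if each of them is.\<close>

lemma set_sum_supporting_hyperplane:
  fixes S :: "'i \<Rightarrow> 'a::euclidean_space set"
  assumes I: "finite I" and le: "\<And>i x. i \<in> I \<Longrightarrow> x \<in> S i \<Longrightarrow> y \<bullet> x \<le> M i"
  shows "(\<Sum>i\<in>I. S i) \<inter> {x. y \<bullet> x = (\<Sum>i\<in>I. M i)} = (\<Sum>i\<in>I. S i \<inter> {x. y \<bullet> x = M i})"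
    and "(\<Sum>i\<in>I. S i) \<subseteq> {x. y \<bullet> x \<le> (\<Sum>i\<in>I. M i)}"
proof -
  have "(\<forall>i\<in>I. y \<bullet> s i = M i)" if "\<forall>i\<in>I. s i \<in> S i" "y \<bullet> (\<Sum>i\<in>I. s i) = (\<Sum>i\<in>I. M i)" for s
  proof -
    have "(\<Sum>i\<in>I. M i - y \<bullet> s i) = 0" using that by (simp add: sum_subtractf inner_sum_right)
    moreover have "\<forall>i\<in>I. 0 \<le> M i - y \<bullet> s i" using that le by simp
    ultimately have "\<forall>i\<in>I. M i - y \<bullet> s i = 0" using I by (simp add: sum_nonneg_eq_0_iff)
    then show ?thesis by simp
  qed
  then show "(\<Sum>i\<in>I. S i) \<inter> {x. y \<bullet> x = (\<Sum>i\<in>I. M i)} = (\<Sum>i\<in>I. S i \<inter> {x. y \<bullet> x = M i})"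
    unfolding set_sum_alt[OF I] by (auto simp: inner_sum_right)
  show "(\<Sum>i\<in>I. S i) \<subseteq> {x. y \<bullet> x \<le> (\<Sum>i\<in>I. M i)}"
    unfolding set_sum_alt[OF I] using le by (auto simp: inner_sum_right intro!: sum_mono)
qed

lemma inner_axis_one: "y \<bullet> axis i 1 = y $ i"
  for y :: "real^'n::finite"
  by (simp add: inner_axis)

definition edge_segment :: "'n set \<Rightarrow> (real^'n::finite) set" where
  "edge_segment e = convex hull ((\<lambda>i. axis i 1) ` e)"

definition edge_max :: "real^'n \<Rightarrow> 'n::finite set \<Rightarrow> real" where
  "edge_max y e = Max (($) y ` e)"

definition edge_face :: "real^'n \<Rightarrow> 'n set \<Rightarrow> (real^'n::finite) set" where
  "edge_face y e = edge_segment e \<inter> {x. y \<bullet> x = edge_max y e}"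

text \<open>Built edge by edge to expose the signs; \<open>zonotope_face_eq\<close> identifies it
  with the maximisers of \<open>y\<close> on the zonotope.\<close>

definition zonotope_face :: "'n set set \<Rightarrow> real^'n \<Rightarrow> (real^'n::finite) set" where
  "zonotope_face E y = (\<Sum>e\<in>E. edge_face y e)"

lemma edge_segment_doubleton: "edge_segment {i, j} = closed_segment (axis i 1) (axis j 1)"
  by (simp add: edge_segment_def segment_convex_hull)

lemma edge_segment_le_max:
  assumes "x \<in> edge_segment {i, j}"
  shows "y \<bullet> x \<le> edge_max y {i, j}"
proof -
  have "edge_segment {i, j} \<subseteq> {x. y \<bullet> x \<le> edge_max y {i, j}}"
    unfolding edge_segment_def
    by (rule hull_minimal) (auto simp: inner_axis_one edge_max_def convex_halfspace_le)
  then show ?thesis using assms by auto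
qed

lemma edge_face_doubleton:
  "edge_face y {i, j} =
    (if y $ i < y $ j then {axis j 1} else if y $ j < y $ i then {axis i 1} else edge_segment {i, j})"
proof -
  \<comment> \<open>The value along the segment is written relative to either end, so that
    maximality forces \<open>u = 0\<close> or \<open>u = 1\<close>.\<close>
  have *: "y \<bullet> ((1 - u) *\<^sub>R axis i 1 + u *\<^sub>R axis j 1) = y $ i + u * (y $ j - y $ i)" for u
    by (simp add: inner_axis_one inner_add_right left_diff_distrib right_diff_distrib)
  have **: "y \<bullet> ((1 - u) *\<^sub>R axis i 1 + u *\<^sub>R axis j 1) = y $ j - (1 - u) * (y $ j - y $ i)" for u
    unfolding * by (simp add: algebra_simps)
  have 1: "edge_face y {i, j} = {axis j 1}" if "y $ i < y $ j"
  proof -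
    have "edge_max y {i, j} = y $ j" using that by (simp add: edge_max_def)
    then show ?thesis using that
      unfolding edge_face_def edge_segment_doubleton
      by (auto simp: closed_segment_def ** inner_axis_one intro!: exI[of _ 1])
  qed
  have 2: "edge_face y {i, j} = {axis i 1}" if "y $ j < y $ i"
  proof -
    have "edge_max y {i, j} = y $ i" using that by (simp add: edge_max_def)
    then show ?thesis using that
      unfolding edge_face_def edge_segment_doubleton
      by (auto simp: closed_segment_def * inner_axis_one intro!: exI[of _ 0])
  qed
  have 3: "edge_face y {i, j} = edge_segment {i, j}" if "y $ i = y $ j"
  proof -
    have "edge_max y {i, j} = y $ i" using that by (simp add: edge_max_def)
    then show ?thesis using that
      unfolding edge_face_def edge_segment_doubleton
      by (auto simp: closed_segment_def * inner_axis)
  qed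
  show ?thesis using 1 2 3 by (auto simp: not_less)
qed

text \<open>The ends of the segment that belong to the face reveal the sign of the edge.\<close>

lemma axis_in_edge_face: "axis i 1 \<in> edge_face y {i, j} \<longleftrightarrow> y $ j \<le> y $ i"
  by (auto simp: edge_face_doubleton edge_segment_doubleton axis_eq_axis)

locale edge_set =
  fixes E :: "'n::finite set set"
  assumes doubleton: "e \<in> E \<Longrightarrow> \<exists>i j. e = {i, j}"
begin

lemma edge_face_nonempty: "e \<in> E \<Longrightarrow> edge_face y e \<noteq> {}"
  using doubleton[of e] by (auto simp: edge_face_doubleton edge_segment_doubleton split: if_splits)

lemma edge_face_choice:
  obtains s where "\<forall>e\<in>E. s e \<in> edge_face y e"
proof
  show "\<forall>e\<in>E. (SOME x. x \<in> edge_face y e) \<in> edge_face y e"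
    using edge_face_nonempty by (simp add: some_in_eq)
qed

lemma graphical_zonotope_eq: "graphical_zonotope E = (\<Sum>e\<in>E. edge_segment e)"
  by (simp add: graphical_zonotope_def edge_segment_def)

lemma edge_segment_le: "e \<in> E \<Longrightarrow> x \<in> edge_segment e \<Longrightarrow> y \<bullet> x \<le> edge_max y e"
  using doubleton[of e] edge_segment_le_max by blast

lemma zonotope_face_eq:
  "zonotope_face E y = graphical_zonotope E \<inter> {x. y \<bullet> x = (\<Sum>e\<in>E. edge_max y e)}"
  unfolding zonotope_face_def edge_face_def graphical_zonotope_eq
  by (rule set_sum_supporting_hyperplane(1) [symmetric]) (auto intro: edge_segment_le)

lemma zonotope_le: "graphical_zonotope E \<subseteq> {x. y \<bullet> x \<le> (\<Sum>e\<in>E. edge_max y e)}"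
  unfolding graphical_zonotope_eq
  by (rule set_sum_supporting_hyperplane(2)) (auto intro: edge_segment_le)

lemma zonotope_face_nonempty: "zonotope_face E y \<noteq> {}"
proof -
  obtain s where "\<forall>e\<in>E. s e \<in> edge_face y e" by (rule edge_face_choice)
  then show ?thesis unfolding zonotope_face_def set_sum_alt[OF finite] by blast
qed

lemma polytope_graphical_zonotope: "polytope (graphical_zonotope E)"
  unfolding graphical_zonotope_eq
  by (rule polytope_set_sum) (simp add: edge_segment_def polytope_convex_hull)

text \<open>Every face of a polytope is exposed, hence cut out by some supporting functional
  \<open>y\<close>.\<close>

lemma face_of_graphical_zonotope:
  "F face_of graphical_zonotope E \<and> F \<noteq> {} \<longleftrightarrow> F \<in> range (zonotope_face E)"
proof
  assume F: "F face_of graphical_zonotope E \<and> F \<noteq> {}"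
  then have "F exposed_face_of graphical_zonotope E"
    using exposed_face_of_polyhedron polytope_graphical_zonotope polytope_imp_polyhedron by blast
  then obtain y b where y: "graphical_zonotope E \<subseteq> {x. y \<bullet> x \<le> b}"
    "F = graphical_zonotope E \<inter> {x. y \<bullet> x = b}"
    unfolding exposed_face_of_def by blast
  \<comment> \<open>The bound \<open>b\<close> is attained at \<open>p\<close> and the sum of the
    edge maxima at \<open>q\<close>; both are upper bounds of \<open>y\<close> on the zonotope, so
    they agree.\<close>
  obtain p where "p \<in> F" using F by blast
  moreover obtain q where "q \<in> zonotope_face E y" using zonotope_face_nonempty by blast
  ultimately have "b = (\<Sum>e\<in>E. edge_max y e)"
    using y zonotope_le[of y] unfolding zonotope_face_eq by force
  then show "F \<in> range (zonotope_face E)" using y(2) zonotope_face_eq by blast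
next
  assume "F \<in> range (zonotope_face E)"
  then obtain y where "F = zonotope_face E y" by blast
  moreover have "graphical_zonotope E \<inter> {x. y \<bullet> x = (\<Sum>e\<in>E. edge_max y e)} face_of graphical_zonotope E"
    by (rule face_of_Int_supporting_hyperplane_le)
      (use zonotope_le polytope_graphical_zonotope polytope_imp_convex in blast)+
  ultimately show "F face_of graphical_zonotope E \<and> F \<noteq> {}"
    using zonotope_face_nonempty by (simp add: zonotope_face_eq)
qed

text \<open>Exchange a single summand of a point of the face for \<open>x\<close>. The result still
  maximises \<open>z\<close>, which forces every summand to be maximal on its segment.\<close>

lemma edge_face_subset:
  assumes "zonotope_face E y \<subseteq> zonotope_face E z" "e \<in> E"
  shows "edge_face y e \<subseteq> edge_face z e"
proof
  fix x assume x: "x \<in> edge_face y e"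
  obtain s where s: "\<forall>e\<in>E. s e \<in> edge_face y e" by (rule edge_face_choice)
  define s' where "s' = s(e := x)"
  have s': "\<forall>e\<in>E. s' e \<in> edge_face y e" using s x by (simp add: s'_def)
  then have "(\<Sum>e\<in>E. s' e) \<in> zonotope_face E y"
    unfolding zonotope_face_def set_sum_alt[OF finite] by blast
  then have "z \<bullet> (\<Sum>e\<in>E. s' e) = (\<Sum>e\<in>E. edge_max z e)"
    using assms(1) zonotope_face_eq by blast
  then have "(\<Sum>e\<in>E. edge_max z e - z \<bullet> s' e) = 0" by (simp add: inner_sum_right sum_subtractf)
  moreover have seg: "s' e \<in> edge_segment e" if "e \<in> E" for e using s' that by (simp add: edge_face_def)
  then have "\<forall>e\<in>E. 0 \<le> edge_max z e - z \<bullet> s' e" using edge_segment_le by simp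
  ultimately have "edge_max z e - z \<bullet> s' e = 0" using assms(2) by (simp add: sum_nonneg_eq_0_iff)
  then show "x \<in> edge_face z e" using seg[OF assms(2)] by (simp add: edge_face_def s'_def)
qed

lemma zonotope_face_eq_iff: "zonotope_face E y = zonotope_face E z \<longleftrightarrow> covector E y = covector E z"
proof
  assume eq: "zonotope_face E y = zonotope_face E z"
  then have "edge_face y e = edge_face z e" if "e \<in> E" for e
    using edge_face_subset[of y z e] edge_face_subset[of z y e] that by auto
  then have "y $ j \<le> y $ i \<longleftrightarrow> z $ j \<le> z $ i" if "{i, j} \<in> E" for i j
    using that axis_in_edge_face by metis
  then show "covector E y = covector E z"
    unfolding covector_def by (auto simp: not_le [symmetric])
next
  assume eq: "covector E y = covector E z"
  have "edge_face y e = edge_face z e" if e: "e \<in> E" for e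
  proof -
    obtain i j where ij: "e = {i, j}" using doubleton e by blast
    have "(i, j) \<in> covector E y \<longleftrightarrow> (i, j) \<in> covector E z" "(j, i) \<in> covector E y \<longleftrightarrow> (j, i) \<in> covector E z"
      using eq by simp_all
    then have "y $ i < y $ j \<longleftrightarrow> z $ i < z $ j" "y $ j < y $ i \<longleftrightarrow> z $ j < z $ i"
      using e unfolding ij covector_def by (simp_all add: insert_commute)
    then show ?thesis by (simp add: ij edge_face_doubleton)
  qed
  then show "zonotope_face E y = zonotope_face E z" by (simp add: zonotope_face_def)
qed

text \<open>Edges of nonzero sign contribute fixed points and those of sign zero full segments, so
  the directions of the face are spanned by the segment directions.\<close>

lemma aff_dim_zonotope_face:
  "aff_dim (zonotope_face E y) = int (dim (zero_vectors E (covector E y)))" (is "_ = int (dim ?Z)")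
proof -
  have Z: "?Z = {axis i 1 - axis j 1 | i j. {i, j} \<in> E \<and> y $ i = y $ j}"
    unfolding zero_vectors_def covector_def by (auto simp: insert_commute not_less order_eq_iff)
  obtain s where s: "\<forall>e\<in>E. s e \<in> edge_face y e" by (rule edge_face_choice)
  define p where "p = (\<Sum>e\<in>E. s e)"
  have p: "p \<in> zonotope_face E y"
    using s unfolding p_def zonotope_face_def set_sum_alt[OF finite] by blast
  have "(\<lambda>x. x - p) ` zonotope_face E y \<subseteq> span ?Z"
  proof clarify
    fix x assume "x \<in> zonotope_face E y"
    then obtain t where t: "\<forall>e\<in>E. t e \<in> edge_face y e" "x = (\<Sum>e\<in>E. t e)"
      unfolding zonotope_face_def set_sum_alt[OF finite] by blast
    have "t e - s e \<in> span ?Z" if e: "e \<in> E" for e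
    proof -
      obtain i j where ij: "e = {i, j}" using doubleton e by blast
      show ?thesis
      proof (cases "y $ i = y $ j")
        case True
        then obtain u w where uw: "t e = (1 - u) *\<^sub>R axis i 1 + u *\<^sub>R axis j 1"
          "s e = (1 - w) *\<^sub>R axis i 1 + w *\<^sub>R axis j 1"
          using s t e by (force simp: ij edge_face_doubleton edge_segment_doubleton closed_segment_def)
        have "axis i 1 - axis j 1 \<in> ?Z" using True e by (auto simp: Z ij)
        then have "(w - u) *\<^sub>R (axis i 1 - axis j 1) \<in> span ?Z" by (intro span_mul span_base)
        then show ?thesis unfolding uw by (simp add: algebra_simps)
      next
        case False
        have "t e \<in> edge_face y e" "s e \<in> edge_face y e" using s t e by auto
        then have "t e = s e" using False by (auto simp: ij edge_face_doubleton split: if_splits)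
        then show ?thesis by (simp add: span_zero)
      qed
    qed
    then show "x - p \<in> span ?Z"
      unfolding t(2) p_def sum_subtractf [symmetric] by (rule span_sum)
  qed
  moreover have "?Z \<subseteq> span ((\<lambda>x. x - p) ` zonotope_face E y)"
  proof
    fix z assume "z \<in> ?Z"
    then obtain i j where z: "z = axis i 1 - axis j 1" and ij: "{i, j} \<in> E" "y $ i = y $ j"
      unfolding Z by blast
    have swap: "p - s {i, j} + x \<in> zonotope_face E y" if "x \<in> edge_face y {i, j}" for x
    proof -
      define t where "t = s({i, j} := x)"
      have "\<forall>e\<in>E. t e \<in> edge_face y e" using s that by (simp add: t_def)
      then have "(\<Sum>e\<in>E. t e) \<in> zonotope_face E y"
        unfolding zonotope_face_def set_sum_alt[OF finite] by blast
      moreover have "(\<Sum>e\<in>E. t e) = p - s {i, j} + x"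
        unfolding p_def t_def using ij(1) by (simp add: sum.remove[OF finite ij(1)])
      ultimately show ?thesis by simp
    qed
    have "axis i 1 \<in> edge_face y {i, j}" "axis j 1 \<in> edge_face y {i, j}"
      using ij axis_in_edge_face[of i y j] axis_in_edge_face[of j y i] by (simp_all add: insert_commute)
    from swap[OF this(1)] swap[OF this(2)]
    have "(p - s {i, j} + axis i 1 - p) - (p - s {i, j} + axis j 1 - p) \<in> span ((\<lambda>x. x - p) ` zonotope_face E y)"
      by (intro span_diff span_base imageI)
    then show "z \<in> span ((\<lambda>x. x - p) ` zonotope_face E y)" by (simp add: z)
  qed
  ultimately have "span ((\<lambda>x. x - p) ` zonotope_face E y) = span ?Z"
    unfolding span_eq by blast
  then have "dim ((\<lambda>x. x - p) ` zonotope_face E y) = dim ?Z" by (metis dim_span)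
  then show ?thesis
    using aff_dim_eq_dim_subtract[OF hull_inc[OF p]] by simp
qed

lemma face_number_eq:
  "face_number (graphical_zonotope E) k = card {\<sigma> \<in> range (covector E). dim (zero_vectors E \<sigma>) = k}"
proof -
  have "bij_betw (\<lambda>\<sigma>. zonotope_face E (SOME y. covector E y = \<sigma>))
     {\<sigma> \<in> range (covector E). dim (zero_vectors E \<sigma>) = k}
     {F. F face_of graphical_zonotope E \<and> aff_dim F = int k}" (is "bij_betw ?f ?A ?B")
  proof -
    have f: "?f (covector E y) = zonotope_face E y" for y
      unfolding zonotope_face_eq_iff by (rule someI) simp
    have "inj_on ?f ?A"
    proof (rule inj_onI)
      fix \<sigma> \<rho> assume \<sigma>: "\<sigma> \<in> ?A" "\<rho> \<in> ?A" "?f \<sigma> = ?f \<rho>"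
      then obtain y z where "\<sigma> = covector E y" "\<rho> = covector E z" by blast
      then show "\<sigma> = \<rho>" using \<sigma>(3) f zonotope_face_eq_iff by metis
    qed
    moreover have "?f ` ?A = ?B"
    proof (intro equalityI subsetI)
      fix F assume "F \<in> ?f ` ?A"
      then obtain y where "F = zonotope_face E y" "dim (zero_vectors E (covector E y)) = k"
        using f by auto
      then show "F \<in> ?B" using face_of_graphical_zonotope[of F] aff_dim_zonotope_face by auto
    next
      fix F assume F: "F \<in> ?B"
      \<comment> \<open>The empty face has affine dimension -1, which is no natural number
        \<open>k\<close>.\<close>
      then have "F \<noteq> {}" by auto
      then obtain y where y: "F = zonotope_face E y" using F face_of_graphical_zonotope[of F] by blast
      then have "covector E y \<in> ?A" using F aff_dim_zonotope_face by auto
      then have "?f (covector E y) \<in> ?f ` ?A" by (rule imageI)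
      then show "F \<in> ?f ` ?A" by (simp only: f y)
    qed
    ultimately show ?thesis by (simp add: bij_betw_def)
  qed
  then show ?thesis unfolding face_number_def by (simp add: bij_betw_same_card)
qed

end

section \<open>Triangulations of convex polygons\<close>

text \<open>Twice the signed area of the triangle \<open>p\<close>, \<open>q\<close>,
  \<open>x\<close>; its sign tells the side of the line through \<open>p\<close> and
  \<open>q\<close> on which \<open>x\<close> lies.\<close>

definition orient :: "real^2 \<Rightarrow> real^2 \<Rightarrow> real^2 \<Rightarrow> real" where
  "orient p q x = (q $ 1 - p $ 1) * (x $ 2 - p $ 2) - (q $ 2 - p $ 2) * (x $ 1 - p $ 1)"

lemma orient_affine: "orient p q ((1 - u) *\<^sub>R x + u *\<^sub>R y) = (1 - u) * orient p q x + u * orient p q y"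
  by (simp add: orient_def algebra_simps)

lemma orient_swap: "orient q p x = - orient p q x"
  by (simp add: orient_def algebra_simps)

lemma orient_rotate: "orient q r p = orient p q r"
  by (simp add: orient_def algebra_simps)

lemma orient_refl: "orient p q p = 0" "orient p q q = 0"
  by (simp_all add: orient_def algebra_simps)

lemma orient_eq_0:
  assumes "orient p q x = 0" "p \<noteq> q"
  obtains u where "x = (1 - u) *\<^sub>R p + u *\<^sub>R q"
proof (cases "q $ 1 = p $ 1")
  case False
  then have "x = (1 - (x $ 1 - p $ 1) / (q $ 1 - p $ 1)) *\<^sub>R p + ((x $ 1 - p $ 1) / (q $ 1 - p $ 1)) *\<^sub>R q"
    using assms(1) by (auto simp: vec_eq_iff forall_2 orient_def divide_simps) (simp_all add: algebra_simps)
  then show thesis by (rule that)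
next
  case True
  then have "q $ 2 \<noteq> p $ 2" using assms(2) by (auto simp: vec_eq_iff forall_2)
  then have "x = (1 - (x $ 2 - p $ 2) / (q $ 2 - p $ 2)) *\<^sub>R p + ((x $ 2 - p $ 2) / (q $ 2 - p $ 2)) *\<^sub>R q"
    using assms(1) True by (auto simp: vec_eq_iff forall_2 orient_def divide_simps) (simp_all add: algebra_simps)
  then show thesis by (rule that)
qed

text \<open>Divided by \<open>orient p q r\<close>, the three orientations are the barycentric
  coordinates of \<open>x\<close>.\<close>

lemma in_triangle_if_orient:
  assumes "orient p q r > 0" "orient p q x \<ge> 0" "orient q r x \<ge> 0" "orient r p x \<ge> 0"
  shows "x \<in> convex hull {p, q, r}"
proof -
  let ?d = "orient p q r"
  have sum: "orient q r x + orient r p x + orient p q x = ?d"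
    by (simp add: orient_def algebra_simps)
  have "?d *\<^sub>R x = orient q r x *\<^sub>R p + orient r p x *\<^sub>R q + orient p q x *\<^sub>R r"
    by (simp add: vec_eq_iff forall_2 orient_def algebra_simps)
  then have "(1 / ?d) *\<^sub>R ?d *\<^sub>R x = (1 / ?d) *\<^sub>R (orient q r x *\<^sub>R p + orient r p x *\<^sub>R q + orient p q x *\<^sub>R r)"
    by simp
  then have "x = (orient q r x / ?d) *\<^sub>R p + (orient r p x / ?d) *\<^sub>R q + (orient p q x / ?d) *\<^sub>R r"
    using assms(1) by (simp add: scaleR_add_right)
  moreover have "orient q r x / ?d + orient r p x / ?d + orient p q x / ?d = 1"
    using assms(1) sum by (simp add: add_divide_distrib [symmetric])
  ultimately show ?thesis
    using assms unfolding convex_hull_3 by (smt (verit) divide_nonneg_pos mem_Collect_eq)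
qed

text \<open>If \<open>x\<close> were on the line but beyond \<open>p\<close> or \<open>q\<close>,
  that point would lie strictly between \<open>x\<close> and the other one, against
  extremality.\<close>

lemma extreme_points_on_line:
  assumes "p extreme_point_of P" "q extreme_point_of P" "p \<noteq> q" "x \<in> P" "orient p q x = 0"
  shows "x \<in> closed_segment p q"
proof -
  obtain u where u: "x = (1 - u) *\<^sub>R p + u *\<^sub>R q" using orient_eq_0 assms(3,5) by metis
  have pq: "p \<in> P" "q \<in> P" "\<And>a b. a \<in> P \<Longrightarrow> b \<in> P \<Longrightarrow> p \<notin> open_segment a b"
    "\<And>a b. a \<in> P \<Longrightarrow> b \<in> P \<Longrightarrow> q \<notin> open_segment a b"
    using assms(1,2) by (auto simp: extreme_point_of_def)
  have "0 \<le> u"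
  proof (rule ccontr)
    assume "\<not> 0 \<le> u"
    then have u0: "u < 0" by simp
    \<comment> \<open>Solving the equation for \<open>x\<close> for \<open>p\<close> gives this
      coefficient of \<open>q\<close>.\<close>
    define w where "w = - u / (1 - u)"
    have w: "0 < w" "w < 1" using u0 by (auto simp: w_def field_simps)
    have "(1 - w) *\<^sub>R x + w *\<^sub>R q = ((1 - w) * (1 - u)) *\<^sub>R p + ((1 - w) * u + w) *\<^sub>R q"
      unfolding u by (simp add: algebra_simps)
    moreover have "(1 - w) * (1 - u) = 1" "(1 - w) * u + w = 0" using u0 by (auto simp: w_def field_simps)
    ultimately have "p = (1 - w) *\<^sub>R x + w *\<^sub>R q" by simp
    moreover have "x \<noteq> q" using assms(3) u u0 by (auto simp: algebra_simps)
    ultimately have "p \<in> open_segment x q" using w unfolding in_segment by blast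
    then show False using pq assms(4) by blast
  qed
  moreover have "u \<le> 1"
  proof (rule ccontr)
    assume "\<not> u \<le> 1"
    then have u0: "u > 1" by simp
    define w where "w = 1 / u"
    have w: "0 < w" "w < 1" using u0 by (auto simp: w_def field_simps)
    have "(1 - w) *\<^sub>R p + w *\<^sub>R x = ((1 - w) + w * (1 - u)) *\<^sub>R p + (w * u) *\<^sub>R q"
      unfolding u by (simp add: algebra_simps)
    moreover have "(1 - w) + w * (1 - u) = 0" "w * u = 1" using u0 by (auto simp: w_def field_simps)
    ultimately have "q = (1 - w) *\<^sub>R p + w *\<^sub>R x" by simp
    moreover have "p \<noteq> x"
    proof
      assume "p = x"
      moreover have "x - p = u *\<^sub>R (q - p)" unfolding u by (simp add: algebra_simps)
      ultimately show False using u0 assms(3) by simp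
    qed
    ultimately have "q \<in> open_segment p x" using w unfolding in_segment by blast
    then show False using pq assms(4) by blast
  qed
  ultimately show ?thesis using u unfolding in_segment by blast
qed

lemma glued_edge: "glued K B \<Longrightarrow> e \<in># B \<Longrightarrow> \<exists>t\<in>K. e \<subseteq> t"
proof (induction arbitrary: e rule: glued.induct)
  case (glue K B a b v)
  then have "e \<in># B \<or> e = {a, v} \<or> e = {b, v}" by (auto dest: in_diffD)
  then show ?case using glue.IH by auto
qed auto

text \<open>Gluing removes only \<open>{p, q}\<close> from the boundary, and this edge then lies in
  two triangles, the new one and an old one.\<close>

lemma glued_boundary:
  "glued K B \<Longrightarrow> a \<noteq> b \<Longrightarrow> \<exists>!t. t \<in> K \<and> a \<in> t \<and> b \<in> t \<Longrightarrow> {a, b} \<in># B"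
proof (induction arbitrary: a b rule: glued.induct)
  case (triangle p q r)
  then show ?case by (auto simp: insert_commute)
next
  case (glue K B p q v)
  obtain s where s: "s \<in> K" "p \<in> s" "q \<in> s" using glued_edge[OF glue.hyps(1,2)] by auto
  have "v \<notin> s" using s glue.hyps by auto
  then have sne: "s \<noteq> {p, q, v}" by auto
  obtain t where t: "t \<in> insert {p, q, v} K" "a \<in> t" "b \<in> t"
    and uniq: "\<And>t'. t' \<in> insert {p, q, v} K \<Longrightarrow> a \<in> t' \<Longrightarrow> b \<in> t' \<Longrightarrow> t' = t"
    using glue.prems(2) by blast
  show ?case
  proof (cases "t = {p, q, v}")
    case True
    have "{a, b} \<noteq> {p, q}"
    proof
      assume "{a, b} = {p, q}"
      then have "s = t" using s by (intro uniq) (auto simp: doubleton_eq_iff)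
      then show False using sne True by simp
    qed
    then have "{a, b} = {p, v} \<or> {a, b} = {q, v}" using t True glue.prems(1) by auto
    then show ?thesis by auto
  next
    case False
    then have tK: "t \<in> K" using t by simp
    have "{a, b} \<in># B"
      by (rule glue.IH[OF glue.prems(1)], rule ex1I[of _ t]) (use t tK uniq in auto)
    moreover have "{a, b} \<noteq> {p, q}"
    proof
      assume "{a, b} = {p, q}"
      then have "a \<in> {p, q, v}" "b \<in> {p, q, v}" by (auto simp: doubleton_eq_iff)
      then have "{p, q, v} = t" by (intro uniq) auto
      then show False using False by simp
    qed
    ultimately have "{a, b} \<in># B - {#{p, q}#}" by (simp add: in_diff_count)
    then show ?thesis by simp
  qed
qed

locale triangulated_polygon =
  fixes P :: "(real^2) set" and v :: "'n::finite \<Rightarrow> real^2" and C :: "'n set set"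
  assumes inj: "inj v" and ext: "{x. x extreme_point_of P} = range v" and conv: "convex P"
    and nonempty: "P \<noteq> {}"
    and card3: "t \<in> C \<Longrightarrow> card t = 3"
    and cover: "(\<Union>t\<in>C. convex hull (v ` t)) = P"
    and face: "s \<in> C \<Longrightarrow> t \<in> C \<Longrightarrow> convex hull (v ` s) \<inter> convex hull (v ` t) face_of convex hull (v ` s)"
begin

abbreviation tri :: "'n set \<Rightarrow> (real^2) set" where "tri t \<equiv> convex hull (v ` t)"

abbreviation side :: "'n \<Rightarrow> 'n \<Rightarrow> 'n \<Rightarrow> real" where "side a b c \<equiv> orient (v a) (v b) (v c)"

lemma v_eq: "v a = v b \<longleftrightarrow> a = b" using inj by (auto dest: injD)

lemma v_extreme: "v i extreme_point_of P" using ext by blast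

lemma tri_sub: "t \<in> C \<Longrightarrow> tri t \<subseteq> P" using cover by blast

text \<open>An extreme point of \<open>P\<close> is extreme in every subset of \<open>P\<close>
  containing it, hence a corner of the triangle.\<close>

lemma vertex_in_tri: "t \<in> C \<Longrightarrow> v i \<in> tri t \<longleftrightarrow> i \<in> t"
proof
  assume t: "t \<in> C" "v i \<in> tri t"
  then have "v i extreme_point_of tri t"
    using v_extreme[of i] tri_sub[OF t(1)] unfolding extreme_point_of_def by blast
  then have "v i \<in> v ` t" by (rule extreme_point_of_convex_hull)
  then show "i \<in> t" using v_eq by auto
qed (auto intro: hull_inc)

lemma third:
  assumes "t \<in> C" "a \<in> t" "b \<in> t" "a \<noteq> b"
  obtains c where "t = {a, b, c}" "c \<noteq> a" "c \<noteq> b"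
proof -
  have "card (t - {a, b}) = 1" using assms card3[OF assms(1)] by (simp add: card_Diff_subset)
  then obtain c where "t - {a, b} = {c}" by (auto simp: card_1_singleton_iff)
  then show thesis using assms by (intro that[of c]) auto
qed

lemma side_nonzero:
  assumes "a \<noteq> b" "c \<noteq> a" "c \<noteq> b"
  shows "side a b c \<noteq> 0"
proof
  assume "side a b c = 0"
  then have "v c \<in> closed_segment (v a) (v b)"
    using extreme_points_on_line[OF v_extreme v_extreme] assms v_eq v_extreme
    by (metis extreme_point_of_def)
  then have "v c \<in> open_segment (v a) (v b)" using assms v_eq by (simp add: open_segment_def)
  then show False using v_extreme unfolding extreme_point_of_def by blast
qed

text \<open>The segment from \<open>v p\<close> to \<open>v q\<close> would meet the line in a point
  \<open>x\<close> of the segment from \<open>v a\<close> to \<open>v b\<close>. The triangles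
  intersect in a face containing \<open>x\<close>, so it contains \<open>v p\<close> and
  \<open>v q\<close> too, and \<open>s\<close> would have four corners.\<close>

lemma no_crossing:
  assumes s: "s \<in> C" "a \<in> s" "b \<in> s" "a \<noteq> b" and t: "t \<in> C" "p \<in> t" "q \<in> t"
    and pos: "side a b p > 0" and neg: "side a b q < 0"
  shows False
proof -
  \<comment> \<open>The parameter at which the affine function \<open>orient (v a) (v b)\<close>
    vanishes.\<close>
  define u where "u = side a b p / (side a b p - side a b q)"
  have u: "0 < u" "u < 1" using pos neg by (auto simp: u_def field_simps)
  define x where "x = (1 - u) *\<^sub>R v p + u *\<^sub>R v q"
  have "v p \<noteq> v q" using pos neg by auto
  then have xo: "x \<in> open_segment (v p) (v q)" using u unfolding x_def in_segment by blast
  have "side a b p - side a b q \<noteq> 0" using pos neg by linarith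
  then have x0: "orient (v a) (v b) x = 0"
    unfolding x_def orient_affine u_def by (simp add: field_simps)
  have pq: "v p \<in> tri t" "v q \<in> tri t" using t by (auto intro: hull_inc)
  then have "x \<in> tri t"
    using xo convex_contains_segment[of "tri t"] by (auto simp: open_segment_def)
  then have "x \<in> closed_segment (v a) (v b)"
    using extreme_points_on_line[OF v_extreme v_extreme _ _ x0] s v_eq tri_sub[OF t(1)] by blast
  then have "x \<in> tri s"
    using s hull_mono[of "{v a, v b}" "v ` s"] by (auto simp: segment_convex_hull)
  then have "v p \<in> tri s" "v q \<in> tri s"
    using face[OF t(1) s(1)] \<open>x \<in> tri t\<close> pq xo unfolding face_of_def by blast+
  then have "{a, b, p, q} \<subseteq> s" using s vertex_in_tri by simp
  moreover have "card {a, b, p, q} = 4"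
    using s(4) pos neg by (auto simp: orient_refl card_insert_if)
  moreover have "finite s" by simp
  ultimately show False using card_mono[of s "{a, b, p, q}"] card3[OF s(1)] by simp
qed

text \<open>By \<open>no_crossing\<close> the point \<open>v d\<close> is not beyond either of the
  other two sides of \<open>s\<close>. It thus lies in that triangle and is one of its
  corners.\<close>

lemma same_side_eq:
  assumes s: "s \<in> C" "s = {a, b, c}" and t: "t \<in> C" "t = {a, b, d}"
    and pos: "side a b c > 0" "side a b d > 0"
  shows "s = t"
proof -
  have ne: "a \<noteq> b" "c \<noteq> a" "c \<noteq> b" "d \<noteq> a" "d \<noteq> b"
    using pos by (auto simp: orient_refl orient_def)
  have bca: "side b c a > 0" using pos(1) by (simp add: orient_rotate)
  have cab: "side c a b > 0" using pos(1) by (metis orient_rotate)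
  have "\<not> side b c d < 0"
    using no_crossing[of s b c t a d] s t ne bca by auto
  moreover have "\<not> side c a d < 0"
    using no_crossing[of s c a t b d] s t ne cab by auto
  ultimately have "v d \<in> convex hull {v a, v b, v c}"
    using in_triangle_if_orient[of "v a" "v b" "v c" "v d"] pos by simp
  then have "d \<in> s" using vertex_in_tri[OF s(1), of d] s(2) by simp
  then show ?thesis using s t ne by auto
qed

lemma opposite_sides:
  assumes "s \<in> C" "s = {a, b, c}" "t \<in> C" "t = {a, b, d}" "s \<noteq> t"
  shows "side a b c > 0 \<and> side a b d < 0 \<or> side a b c < 0 \<and> side a b d > 0"
proof -
  have "card {a, b, c} = 3" "card {a, b, d} = 3" using assms card3 by metis+
  then have ne: "a \<noteq> b" "c \<noteq> a" "c \<noteq> b" "d \<noteq> a" "d \<noteq> b"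
    by (auto simp: card_insert_if split: if_splits)
  then have "side a b c \<noteq> 0" "side a b d \<noteq> 0" using side_nonzero by auto
  moreover have "\<not> (side a b c > 0 \<and> side a b d > 0)" using same_side_eq assms by blast
  moreover have "\<not> (side b a c > 0 \<and> side b a d > 0)"
    using same_side_eq[of s b a c t d] assms by (auto simp: insert_commute)
  ultimately show ?thesis using orient_swap[of "v b" "v a"] by force
qed

text \<open>If \<open>w\<close> were on the negative side, \<open>no_crossing\<close> would put
  \<open>p\<close> and \<open>q\<close> on the line, so \<open>{p, q} = {a, b}\<close>. Then
  \<open>T\<close> would be opposite both to the new triangle and to an old one, which themselves
  lie on different sides.\<close>

lemma glued_side_step:
  assumes K: "glued K B" "K \<subseteq> C" "{p, q} \<in># B" "p \<noteq> q" "{p, q, w} \<in> C"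
    and T: "T \<in> C" "T \<notin> insert {p, q, w} K" "a \<in> T" "b \<in> T" "a \<noteq> b"
    and pos: "\<forall>i\<in>\<Union>K. side a b i \<ge> 0"
  shows "side a b w \<ge> 0"
proof (rule ccontr)
  assume "\<not> side a b w \<ge> 0"
  then have w: "side a b w < 0" by simp
  obtain r where r: "r \<in> K" "p \<in> r" "q \<in> r" using glued_edge[OF K(1,3)] by auto
  have "\<not> side a b p > 0" "\<not> side a b q > 0"
    using no_crossing[OF T(1,3,4,5) K(5) _ _ _ w] by auto
  then have "side a b p = 0" "side a b q = 0" using pos r by force+
  then have "p \<in> {a, b}" "q \<in> {a, b}" using side_nonzero T(5) by blast+
  then have pq: "{p, q} = {a, b}" using K(4) by auto
  have "r \<in> C" using r K(2) by auto
  have "a \<in> r" "b \<in> r" using r pq by (auto simp: doubleton_eq_iff)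
  obtain c where c: "r = {a, b, c}" using third[OF \<open>r \<in> C\<close> \<open>a \<in> r\<close> \<open>b \<in> r\<close> T(5)] by blast
  obtain d where d: "T = {a, b, d}" using third[OF T(1,3,4,5)] by blast
  have pqw: "{p, q, w} = {a, b, w}" using pq by auto
  have "side a b c \<ge> 0" using pos r c by auto
  then have "side a b d < 0"
    using opposite_sides[OF \<open>r \<in> C\<close> c T(1) d] T(2) r by auto
  moreover have "side a b d > 0"
    using opposite_sides[OF K(5) pqw T(1) d] T(2) w by auto
  ultimately show False by simp
qed

text \<open>
  Two adjacent triangles can lie on different sides of the line through \<open>a\<close> and \<open>b\<close> only if
  \<open>{a, b}\<close> is their common edge, and then one of them is \<open>T\<close>.
\<close>

lemma glued_one_side:
  "glued K B \<Longrightarrow> K \<subseteq> C \<Longrightarrow> T \<in> C \<Longrightarrow> T \<notin> K \<Longrightarrow> a \<in> T \<Longrightarrow> b \<in> T \<Longrightarrow> a \<noteq> b \<Longrightarrow>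
    (\<forall>i\<in>\<Union>K. side a b i \<ge> 0) \<or> (\<forall>i\<in>\<Union>K. side a b i \<le> 0)"
proof (induction rule: glued.induct)
  case (triangle p q r)
  then have "\<not> (side a b i > 0 \<and> side a b j < 0)" if "i \<in> {p, q, r}" "j \<in> {p, q, r}" for i j
    using no_crossing[of T a b "{p, q, r}" i j] that by auto
  then show ?case by (smt (verit) UnionE singletonD)
next
  case (glue K B p q w)
  have pq: "p \<in> \<Union>K" "q \<in> \<Union>K" using glued_edge[OF glue.hyps(1,2)] by auto
  have sub: "K \<subseteq> C" "{p, q, w} \<in> C" using glue.prems by auto
  have un: "\<Union>(insert {p, q, w} K) = insert w (\<Union>K)" using pq by auto
  consider "\<forall>i\<in>\<Union>K. side a b i \<ge> 0" | "\<forall>i\<in>\<Union>K. side a b i \<le> 0"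
    using glue.IH glue.prems sub by blast
  then show ?case
  proof cases
    case 1
    have "side a b w \<ge> 0"
      by (rule glued_side_step[OF glue.hyps(1) sub(1) glue.hyps(2,3) sub(2) glue.prems(2-6) 1])
    then show ?thesis using 1 un by auto
  next
    case 2
    then have 2: "\<forall>i\<in>\<Union>K. side b a i \<ge> 0" using orient_swap[of "v b" "v a"] by simp
    have "side b a w \<ge> 0"
      by (rule glued_side_step[OF glue.hyps(1) sub(1) glue.hyps(2,3) sub(2) glue.prems(2,3,5,4) _ 2])
        (use glue.prems in auto)
    then show ?thesis using 2 un orient_swap[of "v b" "v a"] by auto
  qed
qed

text \<open>The intersection is a face of \<open>tri s\<close>, so it is the hull of corners of
  \<open>s\<close>, and these are corners of \<open>t\<close> by
  \<open>vertex_in_tri\<close>.\<close>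

lemma tri_Int:
  assumes "s \<in> C" "t \<in> C"
  shows "tri s \<inter> tri t \<subseteq> tri (s \<inter> t)"
proof -
  have "compact (v ` s)" by (simp add: finite_imp_compact)
  then obtain S where S: "S \<subseteq> v ` s" "tri s \<inter> tri t = convex hull S"
    using face_of_convex_hull_subset face[OF assms] by metis
  have "S \<subseteq> v ` (s \<inter> t)"
  proof
    fix x assume x: "x \<in> S"
    then obtain i where i: "x = v i" "i \<in> s" using S by auto
    have "x \<in> tri t" using x S(2) hull_subset[of S convex] by blast
    then show "x \<in> v ` (s \<inter> t)" using i vertex_in_tri[OF assms(2)] by auto
  qed
  then show ?thesis using S(2) hull_mono by metis
qed

lemma convex_minus_vertices: "convex (P - range v)"
  unfolding convex_contains_segment
proof (intro ballI subsetI)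
  fix x y z assume xy: "x \<in> P - range v" "y \<in> P - range v" and z: "z \<in> closed_segment x y"
  have "z \<in> P" using conv xy z by (auto simp: convex_contains_segment)
  moreover have "z \<notin> range v"
  proof
    assume "z \<in> range v"
    then have "z extreme_point_of P" "z \<noteq> x" "z \<noteq> y" using xy v_extreme by auto
    moreover have "z \<in> open_segment x y" using z calculation by (simp add: open_segment_def)
    ultimately show False using xy unfolding extreme_point_of_def by blast
  qed
  ultimately show "z \<in> P - range v" by simp
qed

lemma tri_minus_vertices_nonempty:
  assumes "t \<in> C"
  shows "tri t - range v \<noteq> {}"
proof -
  obtain a b c where "t = {a, b, c}" "a \<noteq> b"
    using card3[OF assms] by (auto simp: card_3_iff)
  then have ab: "v a \<in> tri t" "v b \<in> tri t" "v a \<noteq> v b" by (auto intro: hull_inc simp: v_eq)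
  define m where "m = midpoint (v a) (v b)"
  have mo: "m \<in> open_segment (v a) (v b)" using ab(3) by (simp add: m_def)
  then have "m \<in> tri t" using ab convex_contains_segment[of "tri t"] by (auto simp: open_segment_def)
  moreover have "m \<notin> range v"
    using mo v_extreme unfolding extreme_point_of_def by blast
  ultimately show ?thesis by blast
qed

text \<open>
  A convex set stays convex, hence connected, when extreme points are removed, so the triangles in
  \<open>K\<close> must meet the remaining ones in more than vertices.
\<close>

lemma adjacent:
  assumes "K \<subseteq> C" "K \<noteq> {}" "K \<noteq> C"
  obtains s t a b where "s \<in> K" "t \<in> C - K" "a \<in> s \<inter> t" "b \<in> s \<inter> t" "a \<noteq> b"
proof (rule ccontr)
  assume no: "\<not> thesis"
  note found = that
  have fin: "finite K" "finite (C - K)" by simp_all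
  define A where "A = (\<Union>t\<in>K. tri t)"
  define D where "D = (\<Union>t\<in>C - K. tri t)"
  have closed: "closed A" "closed D"
    unfolding A_def D_def by (intro closed_UN fin ballI; simp add: compact_imp_closed finite_imp_compact_convex_hull)+
  have "tri s \<inter> tri t \<subseteq> range v" if st: "s \<in> K" "t \<in> C - K" for s t
  proof -
    have one: "a = b" if "a \<in> s \<inter> t" "b \<in> s \<inter> t" for a b using no found st that by blast
    have "tri (s \<inter> t) \<subseteq> range v"
    proof (cases "s \<inter> t = {}")
      case False
      then obtain a where "s \<inter> t = {a}" using one by blast
      then show ?thesis by simp
    qed simp
    then show ?thesis using tri_Int[of s t] st assms(1) by blast
  qed
  then have "A \<inter> D \<inter> (P - range v) = {}" unfolding A_def D_def by blast
  moreover have "P - range v \<subseteq> A \<union> D" unfolding A_def D_def using cover by blast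
  moreover have "A \<inter> (P - range v) \<noteq> {}"
  proof -
    obtain t where t: "t \<in> K" using assms by blast
    then have "t \<in> C" using assms by blast
    then show ?thesis using tri_minus_vertices_nonempty[of t] tri_sub[of t] t unfolding A_def by blast
  qed
  moreover have "D \<inter> (P - range v) \<noteq> {}"
  proof -
    obtain t where t: "t \<in> C - K" using assms by blast
    then show ?thesis using tri_minus_vertices_nonempty[of t] tri_sub[of t] unfolding D_def by blast
  qed
  moreover have "connected (P - range v)" using convex_minus_vertices by (rule convex_connected)
  ultimately show False using closed unfolding connected_closed by blast
qed

text \<open>An edge has only two sides, so no triangle of \<open>K\<close> other than
  \<open>s\<close> contains the common edge, which is therefore a boundary edge. All of
  \<open>K\<close> lies on the side of \<open>c\<close>, whereas \<open>d\<close> is strictly on the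
  other side and hence new.\<close>

lemma glued_extend:
  assumes K: "glued K B" "K \<subseteq> C" "K \<noteq> C"
  obtains K' B' where "glued K' B'" "K \<subset> K'" "K' \<subseteq> C"
proof -
  have "K \<noteq> {}" using K(1) by (cases rule: glued.cases) auto
  then obtain s t a b where st: "s \<in> K" "t \<in> C - K" and ab: "a \<in> s \<inter> t" "b \<in> s \<inter> t" "a \<noteq> b"
    using adjacent K by metis
  have sC: "s \<in> C" "t \<in> C" "s \<noteq> t" using st K by auto
  obtain c where c: "s = {a, b, c}" using third[OF sC(1)] ab by blast
  obtain d where d: "t = {a, b, d}" using third[OF sC(2)] ab by blast
  have "{a, b} \<in># B"
  proof (rule glued_boundary[OF K(1) ab(3)], rule ex1I[of _ s])
    fix r assume r: "r \<in> K \<and> a \<in> r \<and> b \<in> r"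
    then have rC: "r \<in> C" "r \<noteq> t" using st K by auto
    obtain e where e: "r = {a, b, e}" using third[OF rC(1)] r ab(3) by blast
    show "r = s"
    proof (rule ccontr)
      assume "r \<noteq> s"
      then show False
        using opposite_sides[OF rC(1) e sC(1) c] opposite_sides[OF rC(1) e sC(2) d rC(2)]
          opposite_sides[OF sC(1) c sC(2) d sC(3)] by auto
    qed
  qed (use st ab in auto)
  moreover have "d \<notin> \<Union>K"
  proof
    assume "d \<in> \<Union>K"
    moreover have "c \<in> \<Union>K" using st c by auto
    moreover have "(\<forall>i\<in>\<Union>K. side a b i \<ge> 0) \<or> (\<forall>i\<in>\<Union>K. side a b i \<le> 0)"
      by (rule glued_one_side[OF K(1,2), of t]) (use st ab in auto)
    ultimately show False using opposite_sides[OF sC(1) c sC(2) d sC(3)] by fastforce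
  qed
  ultimately have "glued (insert {a, b, d} K) (B - {#{a, b}#} + {#{a, d}, {b, d}#})"
    using glued.glue[OF K(1)] ab(3) by blast
  then show thesis using that[of "insert {a, b, d} K"] st d K(2) by blast
qed

lemma glued_all: obtains B where "glued C B"
proof -
  define \<K> where "\<K> = {K. K \<subseteq> C \<and> (\<exists>B. glued K B)}"
  obtain t where t: "t \<in> C" using cover nonempty by blast
  then obtain a b c where "t = {a, b, c}" "a \<noteq> b" "a \<noteq> c" "b \<noteq> c"
    using card3[OF t] by (auto simp: card_3_iff)
  then have "{t} \<in> \<K>" unfolding \<K>_def using glued.triangle[of a b c] t by auto
  moreover have "finite \<K>" by (rule finite_subset[OF subset_UNIV]) simp
  ultimately obtain K where K: "K \<in> \<K>" and max: "\<And>K'. K' \<in> \<K> \<Longrightarrow> K \<subseteq> K' \<Longrightarrow> K = K'"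
    using finite_has_maximal[of \<K>] by blast
  have "K = C"
  proof (rule ccontr)
    assume "K \<noteq> C"
    then obtain K' B' where "glued K' B'" "K \<subset> K'" "K' \<subseteq> C"
      using glued_extend K unfolding \<K>_def by blast
    then show False using max[of K'] unfolding \<K>_def by blast
  qed
  then show thesis using K that unfolding \<K>_def by blast
qed

lemma Union_C: "\<Union>C = UNIV"
proof -
  have "i \<in> \<Union>C" for i
  proof -
    have "v i \<in> P" using v_extreme[of i] by (simp add: extreme_point_of_def)
    then obtain t where "t \<in> C" "v i \<in> tri t" using cover by blast
    then show ?thesis using vertex_in_tri by blast
  qed
  then show ?thesis by blast
qed

end

section \<open>The face numbers\<close>

text \<open>Coranks refer to dimension \<open>n\<close>, the codimension \<open>i\<close> of a face
  to dimension \<open>n - 1\<close>; hence \<open>Suc i\<close>.\<close>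

lemma coeff_covector_poly:
  fixes E :: "'n::finite set set"
  assumes "i \<le> CARD('n) - 1"
  shows "coeff (covector_poly UNIV E {}) (Suc i) =
    int (card {\<sigma> \<in> range (covector E). dim (zero_vectors E \<sigma>) = CARD('n) - 1 - i})"
proof -
  have "0 < CARD('n)" by simp
  then have iff: "CARD('n) - d = Suc i \<longleftrightarrow> d = CARD('n) - 1 - i" for d using assms by linarith
  have "vanishing E {} = range (covector E)" by (auto simp: vanishing_def)
  then have "coeff (covector_poly UNIV E {}) (Suc i) =
      (\<Sum>\<sigma>\<in>range (covector E). if dim (zero_vectors E \<sigma>) = CARD('n) - 1 - i then 1 else 0)"
    unfolding covector_poly_def by (simp add: coeff_sum coeff_monom iff)
  also have "\<dots> = int (card {\<sigma> \<in> range (covector E). dim (zero_vectors E \<sigma>) = CARD('n) - 1 - i})"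
    by (subst sum.inter_filter [symmetric]) (auto intro: finite_subset[OF subset_UNIV])
  finally show ?thesis .
qed

lemma (in triangulated_polygon) face_number_clique_zonotope:
  assumes "i \<le> CARD('n) - 1"
  shows "int (face_number (graphical_zonotope (clique_edges C)) (CARD('n) - 1 - i)) =
    coeff (stack_poly (CARD('n))) (Suc i)"
proof -
  interpret edge_set "clique_edges C"
    by unfold_locales (auto simp: clique_edges_def)
  obtain B where "glued C B" by (rule glued_all)
  then have "covector_poly UNIV (clique_edges C) {} = stack_poly CARD('n)"
    using stack_count_glued[of C B] by (auto simp: stack_count_def Union_C dest!: spec[of _ "{#}"])
  then show ?thesis
    using coeff_covector_poly[OF assms, of "clique_edges C"] by (simp add: face_number_eq)
qed

section \<open>From geometric triangulations to sets of label triples\<close>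

lemma polygon_triangulation_labels:
  fixes v :: "'n::finite \<Rightarrow> real^2"
  assumes P: "polygon n P" and v: "bij_betw v UNIV {x. x extreme_point_of P}"
    and \<T>: "polygon_triangulation P \<T>"
  defines "C \<equiv> {t. card t = 3 \<and> convex hull (v ` t) \<in> \<T>}"
  shows "triangulated_polygon P v C" and "(\<lambda>t. convex hull (v ` t)) ` C = \<T>"
    and "t \<in> C \<Longrightarrow> \<not> affine_dependent (v ` t)"
proof -
  have inj: "inj v" and ext: "{x. x extreme_point_of P} = range v"
    using v by (auto simp: bij_betw_def)
  have tri: "triangulation \<T>" "\<Union>\<T> = P"
    and simp2: "\<And>T. T \<in> \<T> \<Longrightarrow> 2 simplex T \<and> {x. x extreme_point_of T} \<subseteq> range v"
    using \<T> ext by (auto simp: polygon_triangulation_def)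
  have corners: "\<exists>t. card t = 3 \<and> T = convex hull (v ` t)" if T: "T \<in> \<T>" for T
  proof -
    obtain D where D: "\<not> affine_dependent D" "int (card D) = 3" "T = convex hull D"
      using simp2[OF T] unfolding simplex_def by auto
    then have "{x. x extreme_point_of T} = D"
      by (simp add: extreme_point_of_convex_hull_affine_independent)
    then have "D \<subseteq> range v" using simp2[OF T] by simp
    then obtain t where t: "D = v ` t" by (auto simp: subset_image_iff)
    have "card t = 3" using D(2) t card_image[of v t] inj by (simp add: inj_on_subset)
    then show ?thesis using t D(3) by blast
  qed
  show im: "(\<lambda>t. convex hull (v ` t)) ` C = \<T>"
    using corners unfolding C_def by fast
  show "\<not> affine_dependent (v ` t)" if t: "t \<in> C" for t
  proof -
    have "2 simplex (convex hull (v ` t))" using simp2 t by (simp add: C_def)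
    then have "aff_dim (v ` t) = 2" by (metis aff_dim_convex_hull aff_dim_simplex)
    moreover have "card (v ` t) = 3" using t card_image[of v t] inj by (simp add: C_def inj_on_subset)
    ultimately show ?thesis by (simp add: affine_independent_iff_card)
  qed
  show "triangulated_polygon P v C"
  proof
    show "inj v" by (fact inj)
    show "{x. x extreme_point_of P} = range v" by (fact ext)
    show "convex P" using P by (simp add: polygon_def polytope_imp_convex)
    show "P \<noteq> {}" using P by (auto simp: polygon_def)
    show "card t = 3" if "t \<in> C" for t using that by (simp add: C_def)
    show "(\<Union>t\<in>C. convex hull (v ` t)) = P" using im tri(2) by simp
    show "convex hull (v ` s) \<inter> convex hull (v ` t) face_of convex hull (v ` s)"
      if "s \<in> C" "t \<in> C" for s t
      using that tri(1) by (simp add: C_def triangulation_def)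
  qed
qed

context triangulated_polygon begin

text \<open>Some triangle contains the midpoint of the side. It meets the side in one of its own
  faces, spanned by corners among \<open>v i\<close> and \<open>v j\<close>, and the midpoint
  requires both.\<close>

lemma polygon_edge_in_tri:
  assumes seg: "closed_segment (v i) (v j) face_of P" and "i \<noteq> j"
  obtains t where "t \<in> C" "i \<in> t" "j \<in> t"
proof -
  define m where "m = midpoint (v i) (v j)"
  have ij: "v i \<noteq> v j" using assms(2) v_eq by simp
  have m: "m \<in> closed_segment (v i) (v j)" by (simp add: m_def)
  then have "m \<in> P" using seg face_of_imp_subset by blast
  then obtain t where t: "t \<in> C" "m \<in> tri t" using cover by blast
  have "P \<inter> tri t = tri t" using tri_sub[OF t(1)] by blast
  then have "closed_segment (v i) (v j) \<inter> tri t face_of tri t"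
    using face_of_slice[OF seg, of "tri t"] by simp
  moreover have "compact (v ` t)" by (simp add: finite_imp_compact)
  ultimately obtain S where S: "S \<subseteq> v ` t" "closed_segment (v i) (v j) \<inter> tri t = convex hull S"
    using face_of_convex_hull_subset by metis
  have "S \<subseteq> {v i, v j}"
  proof
    fix x assume x: "x \<in> S"
    then have "x extreme_point_of P" using S(1) v_extreme by auto
    moreover have "x \<in> closed_segment (v i) (v j)" using x S(2) hull_subset[of S convex] by blast
    moreover have "v i \<in> P" "v j \<in> P" using v_extreme by (auto simp: extreme_point_of_def)
    ultimately show "x \<in> {v i, v j}" unfolding extreme_point_of_def open_segment_def by blast
  qed
  then consider "S = {}" | "S = {v i}" | "S = {v j}" | "S = {v i, v j}" by blast
  moreover have "m \<in> convex hull S" using S(2) m t(2) by blast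
  moreover have "m \<noteq> v i" "m \<noteq> v j" using ij by (simp_all add: m_def)
  ultimately have "S = {v i, v j}" by cases auto
  then have "i \<in> t" "j \<in> t" using S(1) v_eq by auto
  then show thesis using t(1) that by blast
qed

end

text \<open>Sides of the polygon are sides of triangles by \<open>polygon_edge_in_tri\<close>;
  conversely, any two corners of an affinely independent triple span an edge of its hull.\<close>

lemma skeleton_edges_eq:
  fixes v :: "'n::finite \<Rightarrow> real^2"
  assumes P: "polygon n P" and v: "bij_betw v UNIV {x. x extreme_point_of P}"
    and \<T>: "polygon_triangulation P \<T>"
  shows "skeleton_edges v P \<T> = clique_edges {t. card t = 3 \<and> convex hull (v ` t) \<in> \<T>}"
proof -
  define C where "C = {t. card t = 3 \<and> convex hull (v ` t) \<in> \<T>}"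
  note lab = polygon_triangulation_labels[OF assms, folded C_def]
  interpret triangulated_polygon P v C by (rule lab(1))
  have "closed_segment (v i) (v j) edge_of P \<or> (\<exists>T\<in>\<T>. closed_segment (v i) (v j) edge_of T) \<longleftrightarrow>
      i \<noteq> j \<and> (\<exists>t\<in>C. i \<in> t \<and> j \<in> t)" (is "?L \<longleftrightarrow> ?R") for i j
  proof
    assume L: ?L
    then have "aff_dim (closed_segment (v i) (v j)) = 1" by (auto simp: edge_of_def)
    then have "i \<noteq> j" by auto
    from L consider "closed_segment (v i) (v j) face_of P"
      | T where "T \<in> \<T>" "closed_segment (v i) (v j) face_of T"
      by (auto simp: edge_of_def)
    then have "\<exists>t\<in>C. i \<in> t \<and> j \<in> t"
    proof cases
      case 1
      obtain t where "t \<in> C" "i \<in> t" "j \<in> t"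
        by (rule polygon_edge_in_tri[OF 1 \<open>i \<noteq> j\<close>])
      then show ?thesis by blast
    next
      case 2
      then obtain t where t: "t \<in> C" "T = tri t" using lab(2) by blast
      then have "v i \<in> tri t" "v j \<in> tri t" using 2 face_of_imp_subset by fastforce+
      then show ?thesis using t(1) vertex_in_tri[OF t(1)] by blast
    qed
    then show ?R using \<open>i \<noteq> j\<close> by simp
  next
    assume ?R
    then obtain t where t: "t \<in> C" "i \<in> t" "j \<in> t" and ij: "i \<noteq> j" by blast
    have "convex hull {v i, v j} face_of tri t"
      unfolding face_of_convex_hull_affine_independent[OF lab(3)[OF t(1)]]
      using t by (intro exI[of _ "{v i, v j}"]) auto
    moreover have "aff_dim (convex hull {v i, v j}) = 1"
      using ij v_eq[of i j] by (simp add: aff_dim_convex_hull aff_dim_2)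
    ultimately have "closed_segment (v i) (v j) edge_of tri t"
      by (simp add: edge_of_def segment_convex_hull)
    moreover have "tri t \<in> \<T>" using t(1) by (simp add: C_def)
    ultimately show ?L by blast
  qed
  then show ?thesis by (simp add: skeleton_edges_def clique_edges_def flip: C_def)
qed

theorem theorem3p1:
  fixes n i :: nat
    and P :: "(real^2) set"
    and \<T> :: "(real^2) set set"
    and v :: "'n::finite \<Rightarrow> real^2"
  assumes "n \<ge> 3"
    and "CARD('n) = n"
    and "polygon n P"
    and "bij_betw v UNIV {x. x extreme_point_of P}"
    and "polygon_triangulation P \<T>"
    and "i \<le> n - 1"
  shows "face_number (graphical_zonotope (skeleton_edges v P \<T>)) (n - 1 - i) =
    (\<Sum>m = 0..min i (n - i).
       2 ^ m * 3 ^ (i - m) * binom (int i - 1) (int m - 1) * (n choose (m + i)))"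
proof -
  let ?C = "{t. card t = 3 \<and> convex hull (v ` t) \<in> \<T>}"
  interpret triangulated_polygon P v ?C
    by (rule polygon_triangulation_labels(1)[OF assms(3-5)])
  have "int (face_number (graphical_zonotope (skeleton_edges v P \<T>)) (n - 1 - i)) =
      coeff (stack_poly n) (Suc i)"
    using face_number_clique_zonotope[of i] assms(2,6) by (simp add: skeleton_edges_eq[OF assms(3-5)])
  also have "\<dots> = int (\<Sum>m = 0..min i (n - i).
       2 ^ m * 3 ^ (i - m) * binom (int i - 1) (int m - 1) * (n choose (m + i)))"
    by (rule coeff_stack_poly) (use assms(6) in linarith)
  finally show ?thesis by (simp only: of_nat_eq_iff)
qed

end
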